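(* Let $p>1$ and $p'$ be positive coprime integers with $p+p'\in 2\mathbb Z$ and $p,\frac{p+p'}{2}$ coprime, let $k$ be defined by $k+\frac32=\frac{p}{2p'}$, and set $\Delta=p+p'$. Let $r,s$ be integers with $1\le r\le p-1$, $0\le s\le p'-1$ and $r+s$ odd. Then, as meromorphic functions of $(z,\tau)$ with $z\in\mathbb C$ and $\operatorname{Im}\tau>0$, $$\operatorname{ch}[M_{j_{r,s}}](z,\tau)=\sum_{i=1}^{\frac{\Delta}{2}-1}\operatorname{ch}[\mathcal D^+_{i,s}](z,\tau)\,\operatorname{ch}[V_{i,r}](\tau).$$
   Context: Write $w^{x}=e^{2\pi i x z}$ and $q^{x}=e^{2\pi i x\tau}$ for rational $x$. For integers $r,s$ with $s>0$ put $$\Theta_{r,s}(z,\tau)=\sum_{m\in\mathbb Z}w^{s(m+\frac{r}{2s})}q^{s(m+\frac{r}{2s})^2},$$ and put $\vartheta_2(z,\tau)=\sum_{n\in\mathbb Z}w^{n+\frac12}q^{\frac12(n+\frac12)^2}$, $\vartheta_1(z,\tau)=-\vartheta_2(z+\tfrac12,\tau)$, $\eta(\tau)=q^{1/24}\prod_{n\ge1}(1-q^n)$. The three families of characters (meromorphically continued) are given by the following formulas. (1) $M_{j_{r,s}}$ is the irreducible highest-weight module of $\widehat{\mathfrak{osp}(1|2)}$ at level $k$ with labels $(r,s)$; with $b_\pm=\pm p'r-ps$ and $a=pp'$, $$\operatorname{ch}[M_{j_{r,s}}](z,\tau)=\frac{\Theta_{b_+,a}\left(\frac{z}{2p'},\frac\tau2\right)-\Theta_{b_-,a}\left(\frac{z}{2p'},\frac\tau2\right)}{\Pi(z,\tau)},$$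 where $$\Pi(z,\tau)=\Theta_{1,3}\left(\tfrac z2,\tfrac\tau2\right)-\Theta_{-1,3}\left(\tfrac z2,\tfrac\tau2\right)=w^{\frac14}q^{\frac1{24}}\prod_{n\ge1}\frac{(1-q^n)(1-wq^n)(1-w^{-1}q^{n-1})}{(1+w^{\frac12}q^n)(1+w^{-\frac12}q^{n-1})}.$$ (2) $\mathcal D^+_{i,s}$ ($1\le i\le\frac\Delta2-1$, $0\le s\le p'-1$) is the irreducible highest-weight module of the simple affine vertex operator algebra $L_k(\mathfrak{sl}_2)$, where $k+2=\frac{\Delta}{2p'}$, with $$\operatorname{ch}[\mathcal D^+_{i,s}](z,\tau)=\frac{\Theta_{2p'i-\Delta s,\Delta p'}\left(\frac{z}{2p'},\frac\tau2\right)-\Theta_{-2p'i-\Delta s,\Delta p'}\left(\frac{z}{2p'},\frac\tau2\right)}{i_{\mathbb C}\,\vartheta_1(z,\tau)},\qquad i_{\mathbb C}=\sqrt{-1}.$$ (3) $V_{i,r}$ ($1\le i\le\frac\Delta2-1$, $1\le r\le p-1$) is the simple module of the rational Virasoro vertex operator algebra $\mathrm{Vir}(p,\frac\Delta2)$ (central charge $1-6\frac{(u-p)^2}{up}$, $u=\frac\Delta2$), with $$\operatorname{ch}[V_{i,r}](\tau)=\frac{\Theta_{2pi-\Delta r,\Delta p}\left(0,\frac\tau2\right)-\Theta_{-2pi-\Delta r,\Delta p}\left(0,\frac\tau2\right)}{\eta(\tau)}.$$ *)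

theory Defs
  imports "HOL-Complex_Analysis.Complex_Analysis"
begin

subsection \<open>Meromorphic functions of two complex variables\<close>

text \<open>Meant for open sets: the derivative at each point is required to be complex linear.\<close>

definition holomorphic2_on :: "(complex \<times> complex \<Rightarrow> complex) \<Rightarrow> (complex \<times> complex) set \<Rightarrow> bool"
  where "holomorphic2_on f D \<longleftrightarrow>
    (\<forall>x\<in>D. \<exists>a b. (f has_derivative (\<lambda>(h, k). a * h + b * k)) (at x))"

text \<open>
  A meromorphic function is locally a quotient of holomorphic functions whose denominator
  vanishes identically on no nonempty open set. It is represented by a total function;
  the values at zeros of the denominator are irrelevant.
\<close>

definition meromorphic2_on :: "(complex \<times> complex \<Rightarrow> complex) \<Rightarrow> (complex \<times> complex) set \<Rightarrow> bool"
  where "meromorphic2_on f D \<longleftrightarrow>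
    (\<forall>x\<in>D. \<exists>U g h. open U \<and> x \<in> U \<and> U \<subseteq> D \<and> holomorphic2_on g U \<and> holomorphic2_on h U \<and>
       U \<subseteq> closure {y \<in> U. h y \<noteq> 0} \<and> (\<forall>y\<in>U. h y \<noteq> 0 \<longrightarrow> f y = g y / h y))"

text \<open>
  Two total functions represent the same meromorphic function iff both are meromorphic and
  they agree on a dense open subset of the domain.
\<close>

definition meromorphic2_eq_on ::
    "(complex \<times> complex) set \<Rightarrow> (complex \<times> complex \<Rightarrow> complex) \<Rightarrow> (complex \<times> complex \<Rightarrow> complex) \<Rightarrow> bool"
  where "meromorphic2_eq_on D f g \<longleftrightarrow>
    meromorphic2_on f D \<and> meromorphic2_on g D \<and>
    (\<exists>U. open U \<and> U \<subseteq> D \<and> D \<subseteq> closure U \<and> (\<forall>x\<in>U. f x = g x))"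

subsection \<open>Theta functions and the eta function\<close>

text \<open>
  \<open>epow x z\<close> is $e^{2\pi i x z}$, so that $w^x$ is \<open>epow x z\<close> and $q^x$ is \<open>epow x \<tau>\<close>;
  fractional powers of $w$ and $q$ thus involve no choice of branch.
\<close>

definition epow :: "real \<Rightarrow> complex \<Rightarrow> complex"
  where "epow x z = exp (2 * of_real pi * \<i> * of_real x * z)"

definition Theta :: "int \<Rightarrow> int \<Rightarrow> complex \<Rightarrow> complex \<Rightarrow> complex"
  where "Theta r s z \<tau> =
    (\<Sum>\<^sub>\<infinity>m\<in>(UNIV :: int set).
       epow (of_int s * (of_int m + of_int r / (2 * of_int s))) z *
       epow (of_int s * (of_int m + of_int r / (2 * of_int s))\<^sup>2) \<tau>)"

definition theta2 :: "complex \<Rightarrow> complex \<Rightarrow> complex"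
  where "theta2 z \<tau> =
    (\<Sum>\<^sub>\<infinity>n\<in>(UNIV :: int set). epow (of_int n + 1/2) z * epow (1/2 * (of_int n + 1/2)\<^sup>2) \<tau>)"

definition theta1 :: "complex \<Rightarrow> complex \<Rightarrow> complex"
  where "theta1 z \<tau> = - theta2 (z + 1/2) \<tau>"

definition dedekind_eta :: "complex \<Rightarrow> complex"
  where "dedekind_eta \<tau> = epow (1/24) \<tau> * (\<Prod>n. 1 - epow (of_nat (Suc n)) \<tau>)"

subsection \<open>The characters\<close>

text \<open>By the quintuple product identity, $\Pi$ equals
  $w^{1/4} q^{1/24} \prod_{n\ge1}
    \frac{(1-q^n)(1-wq^n)(1-w^{-1}q^{n-1})}{(1+w^{1/2}q^n)(1+w^{-1/2}q^{n-1})}$.\<close>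

definition Pi_osp :: "complex \<Rightarrow> complex \<Rightarrow> complex"
  where "Pi_osp z \<tau> = Theta 1 3 (z/2) (\<tau>/2) - Theta (-1) 3 (z/2) (\<tau>/2)"

text \<open>The module $M_{j_{r,s}}$ of $\widehat{\mathfrak{osp}(1|2)}$ at level $k$, where
  $k + \frac32 = \frac{p}{2p'}$.\<close>

definition ch_M :: "int \<Rightarrow> int \<Rightarrow> int \<Rightarrow> int \<Rightarrow> complex \<Rightarrow> complex \<Rightarrow> complex"
  where "ch_M p p' r s z \<tau> =
    (Theta (p' * r - p * s) (p * p') (z / (2 * of_int p')) (\<tau>/2)
     - Theta (- p' * r - p * s) (p * p') (z / (2 * of_int p')) (\<tau>/2)) / Pi_osp z \<tau>"

text \<open>The module $\mathcal{D}^+_{i,s}$ of $L_k(\mathfrak{sl}_2)$, where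
  $k + 2 = \frac{\Delta}{2p'}$.\<close>

definition ch_D :: "int \<Rightarrow> int \<Rightarrow> int \<Rightarrow> int \<Rightarrow> complex \<Rightarrow> complex \<Rightarrow> complex"
  where "ch_D \<Delta> p' i s z \<tau> =
    (Theta (2 * p' * i - \<Delta> * s) (\<Delta> * p') (z / (2 * of_int p')) (\<tau>/2)
     - Theta (- 2 * p' * i - \<Delta> * s) (\<Delta> * p') (z / (2 * of_int p')) (\<tau>/2)) / (\<i> * theta1 z \<tau>)"

text \<open>The module $V_{i,r}$ of $\mathrm{Vir}(p, \frac{\Delta}{2})$.\<close>

definition ch_V :: "int \<Rightarrow> int \<Rightarrow> int \<Rightarrow> int \<Rightarrow> complex \<Rightarrow> complex"
  where "ch_V \<Delta> p i r \<tau> =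
    (Theta (2 * p * i - \<Delta> * r) (\<Delta> * p) 0 (\<tau>/2)
     - Theta (- 2 * p * i - \<Delta> * r) (\<Delta> * p) 0 (\<tau>/2)) / dedekind_eta \<tau>"

end

theory Submission
  imports Defs "HOL-Real_Asymp.Real_Asymp"
begin

text \<open>
  Multiplying the numerator of the character of $M_{j_{r,s}}$ by $\vartheta_2(z/2,\tau)$ gives a
  sum over $\mathbb{Z}^2$. The rotation $(x,y)\mapsto(x+p'y,\,x-py)$ diagonalises its
  quadratic form anew and identifies the two terms of the numerator with the sums over the pairs
  $(T,T')$ with $T\equiv T'$ and $T\equiv-T'$ modulo $\Delta$. Decomposing by the residue of $T$,
  the classes $0$ and $\Delta/2$ cancel and the remaining ones pair up to the products of the
  numerators of $\mathcal{D}^+_{i,s}$ and $V_{i,r}$. It remains to compare denominators: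
  $\Pi(z,\tau)\,\vartheta_2(z/2,\tau) = i\,\vartheta_1(z,\tau)\,\eta(\tau)$ is the same
  identity for $p=3$, $p'=1$, $r=1$, $s=0$, once $\eta$ is written as a theta series by
  Euler's pentagonal number theorem.
\<close>

subsection \<open>The pentagonal number theorem\<close>

text \<open>Multiplying by \<open>theta2 (z/2) \<tau>\<close> is forced by the variable z. With x =
  a(m + b/(2a)) from the numerator (a = pp') and y = n + 1/2 from the extra factor, the exponent of
  w in the product is (x + p'y)/(2p') and that of q is x^2/(2pp') + y^2/2. So x + p'y carries all of
  z, and x - py is the direction orthogonal to it for the quadratic form: the sum over it depends on
  \<tau> alone, as a Virasoro character must. The rotated coordinates are integers up to fixed
  shifts because (r + s + 1)/2 is an integer, and the congruence between T and T' records that the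
  rotation has determinant -\<Delta> on the integer indices. The auxiliary factor has zeros, so it
  can be cancelled only away from them. An equality of meromorphic functions therefore also needs
  holomorphy in both variables and denominators that are nonzero on a dense set; by the identity
  theorem a single explicit point where they do not vanish is enough. Since eta is defined by a
  product while everything else is a series, the pentagonal number theorem is the bridge between the
  two.\<close>

text \<open>Shanks' finite form of Euler's identity: on the left, only the term \<open>s = 0\<close> survives
  in the limit.\<close>

lemma pentagonal_finite:
  fixes q :: "'a::comm_ring_1"
  shows "(\<Sum>s\<le>n. (-1) ^ s * (\<Prod>j\<in>{s<..n}. 1 - q ^ j) * q ^ (s * n + s * (s + 1) div 2))
    = 1 + (\<Sum>k=1..n. (-1) ^ k * (q ^ (k * (3 * k - 1) div 2) + q ^ (k * (3 * k + 1) div 2)))"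
proof (induction n)
  case 0
  show ?case by simp
next
  case (Suc n)
  define P where "P s m = (\<Prod>j\<in>{s<..m}. 1 - q ^ j)" for s m :: nat
  define t where "t s = s * (s + 1) div 2" for s :: nat
  have t_Suc: "t (Suc s) = t s + Suc s" for s by (simp add: t_def)
  have P_Suc: "P s (Suc n) = P s n * (1 - q ^ Suc n)" if "s \<le> n" for s
  proof -
    have "{s<..Suc n} = insert (Suc n) {s<..n}" using that by auto
    then show ?thesis by (simp add: P_def)
  qed
  have P_Suc': "P s n * (1 - q ^ s) = P (s - 1) n" if "1 \<le> s" "s \<le> n" for s
  proof -
    have "{s - 1<..n} = insert s {s<..n}" using that by auto
    then show ?thesis by (simp add: P_def)
  qed
  have step: "(\<Sum>s\<le>n. (-1) ^ s * P s (Suc n) * q ^ (s * Suc n + t s)) =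
      (\<Sum>s\<le>n. (-1) ^ s * P s n * q ^ (s * n + t s)) - (-1) ^ n * q ^ (n * n + t n + n + n + 1)"
  proof -
    \<comment> \<open>The increment comes from (1 - q^(n+1)) q^s - 1 = -(1 - q^s) - q^(n+s+1). In
      the first part 1 - q^s extends the product downwards, which shifts s by one and telescopes
      against \<open>a\<close>; the term s = 0 drops out since 1 - q^0 = 0.\<close>
    define a where "a s = (-1) ^ s * P s n * q ^ (s * n + t s + n + s + 1)" for s
    have d: "(-1) ^ s * P s (Suc n) * q ^ (s * Suc n + t s) - (-1) ^ s * P s n * q ^ (s * n + t s)
        = - ((-1) ^ s * (P s n * (1 - q ^ s)) * q ^ (s * n + t s)) - a s" if "s \<le> n" for s
      by (simp add: P_Suc[OF that] a_def algebra_simps power_add)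
    have "(\<Sum>s\<le>n. (-1) ^ s * (P s n * (1 - q ^ s)) * q ^ (s * n + t s)) = - (\<Sum>s<n. a s)"
    proof -
      have "(\<Sum>s\<le>n. (-1) ^ s * (P s n * (1 - q ^ s)) * q ^ (s * n + t s)) =
        (\<Sum>s<n. (-1) ^ Suc s * (P (Suc s) n * (1 - q ^ Suc s)) * q ^ (Suc s * n + t (Suc s)))"
        by (subst lessThan_Suc_atMost[symmetric], subst sum.lessThan_Suc_shift) simp
      also have "\<dots> = (\<Sum>s<n. - a s)"
      proof (rule sum.cong[OF refl])
        fix s assume "s \<in> {..<n}"
        then have "P (Suc s) n * (1 - q ^ Suc s) = P s n" using P_Suc'[of "Suc s"] by simp
        then show "(-1) ^ Suc s * (P (Suc s) n * (1 - q ^ Suc s)) * q ^ (Suc s * n + t (Suc s)) = - a s"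
          by (simp only: a_def t_Suc) (simp add: algebra_simps)
      qed
      finally show ?thesis by (simp add: sum_negf)
    qed
    then have "(\<Sum>s\<le>n. (-1) ^ s * P s (Suc n) * q ^ (s * Suc n + t s)) - (\<Sum>s\<le>n. (-1) ^ s * P s n * q ^ (s * n + t s))
       = (\<Sum>s<n. a s) - (\<Sum>s\<le>n. a s)"
      unfolding sum_subtractf[symmetric] by (subst sum.cong[OF refl d]) (simp_all add: sum_subtractf sum_negf)
    also have "\<dots> = - a n"
      by (simp add: lessThan_Suc_atMost[symmetric])
    finally show ?thesis
      by (simp add: a_def P_def algebra_simps)
  qed
  \<comment> \<open>The term left over from telescoping and the new summand s = n + 1 supply the two
    pentagonal exponents for k = n + 1.\<close>
  have e1: "n * n + t n + n + n + 1 = Suc n * (3 * Suc n - 1) div 2"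
    and e2: "Suc n * Suc n + t (Suc n) = Suc n * (3 * Suc n + 1) div 2"
  proof -
    have t2: "2 * t m = m * (m + 1)" for m unfolding t_def by simp
    have "2 * (n * n + t n + n + n + 1) = Suc n * (3 * Suc n - 1)"
      using t2[of n] by (simp add: algebra_simps)
    then show "n * n + t n + n + n + 1 = Suc n * (3 * Suc n - 1) div 2" by presburger
    have "2 * (Suc n * Suc n + t (Suc n)) = Suc n * (3 * Suc n + 1)"
      using t2[of "Suc n"] by (simp add: algebra_simps)
    then show "Suc n * Suc n + t (Suc n) = Suc n * (3 * Suc n + 1) div 2" by presburger
  qed
  have "(\<Sum>s\<le>Suc n. (-1) ^ s * P s (Suc n) * q ^ (s * Suc n + t s)) =
     (\<Sum>s\<le>n. (-1) ^ s * P s n * q ^ (s * n + t s))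
     + (-1) ^ Suc n * (q ^ (Suc n * (3 * Suc n - 1) div 2) + q ^ (Suc n * (3 * Suc n + 1) div 2))"
    unfolding sum.atMost_Suc step e1 e2
    by (simp add: P_def ring_distribs)
  also have "(\<Sum>s\<le>n. (-1) ^ s * P s n * q ^ (s * n + t s)) =
      1 + (\<Sum>k=1..n. (-1) ^ k * (q ^ (k * (3 * k - 1) div 2) + q ^ (k * (3 * k + 1) div 2)))"
    using Suc.IH by (simp only: P_def t_def)
  finally show ?case
    by (simp only: P_def t_def sum.cl_ivl_Suc add.assoc) simp
qed

theorem pentagonal_number:
  fixes q :: complex
  assumes q: "norm q < 1"
  shows "(\<lambda>n. 1 + (\<Sum>k=1..n. (-1) ^ k * (q ^ (k * (3 * k - 1) div 2) + q ^ (k * (3 * k + 1) div 2))))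
     \<longlonglongrightarrow> (\<Prod>n. 1 - q ^ Suc n)"
    and "(\<Prod>n. 1 - q ^ Suc n) \<noteq> 0"
proof -
  have sq: "summable (\<lambda>n. norm q ^ Suc n)"
    using q by (simp add: summable_geometric)
  have nz: "1 - q ^ Suc n \<noteq> 0" for n
  proof
    assume "1 - q ^ Suc n = 0"
    then have "norm q ^ Suc n = 1" by (simp add: norm_power[symmetric] del: power_Suc)
    then show False using q power_Suc_less_one[of "norm q" n] by (cases "q = 0") auto
  qed
  have "abs_convergent_prod (\<lambda>n. 1 - q ^ Suc n)"
    using sq by (intro summable_imp_abs_convergent_prod) (simp add: norm_power norm_mult)
  then have cp: "convergent_prod (\<lambda>n. 1 - q ^ Suc n)"
    by (rule abs_convergent_prod_imp_convergent_prod)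
  show "(\<Prod>n. 1 - q ^ Suc n) \<noteq> 0"
    using cp nz by (rule prodinf_nonzero)
  have lim0: "(\<lambda>n. \<Prod>j\<in>{0<..n}. 1 - q ^ j) \<longlonglongrightarrow> (\<Prod>n. 1 - q ^ Suc n)"
  proof -
    have eq: "(\<Prod>j\<in>{0<..n}. 1 - q ^ j) = (\<Prod>i<n. 1 - q ^ Suc i)" for n
      by (rule prod.reindex_bij_witness[of _ Suc "\<lambda>j. j - 1"]) auto
    show ?thesis unfolding eq
      using convergent_prod_LIMSEQ[OF cp] LIMSEQ_lessThan_iff_atMost by blast
  qed
  \<comment> \<open>One constant bounds the products for all s and n: replacing 1 - q^j by 1 + |q|^j
    makes every factor at least 1, so missing factors can only lower the value.\<close>
  obtain C where C: "\<And>n. (\<Prod>i<n. 1 + norm q ^ Suc i) \<le> C"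
  proof -
    have "abs_convergent_prod (\<lambda>n. 1 + complex_of_real (norm q ^ Suc n))"
      using sq by (intro summable_imp_abs_convergent_prod) (simp add: norm_power norm_mult)
    then have "convergent (\<lambda>n. \<Prod>i\<le>n. 1 + norm q ^ Suc i)"
      unfolding abs_convergent_prod_altdef by (simp add: norm_mult norm_power)
    then have "convergent (\<lambda>n. \<Prod>i<n. 1 + norm q ^ Suc i)"
      unfolding convergent_def using LIMSEQ_lessThan_iff_atMost by blast
    then have "Bseq (\<lambda>n. \<Prod>i<n. 1 + norm q ^ Suc i)" by (rule convergent_imp_Bseq)
    then obtain K where "\<And>n. norm (\<Prod>i<n. 1 + norm q ^ Suc i) \<le> K" by (auto simp: Bseq_def)
    then show ?thesis using that[of K] by (metis abs_le_iff real_norm_def)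
  qed
  have Pb: "norm (\<Prod>j\<in>{s<..n}. 1 - q ^ j) \<le> C" for s n
  proof -
    have "norm (\<Prod>j\<in>{s<..n}. 1 - q ^ j) \<le> (\<Prod>j\<in>{s<..n}. 1 + norm q ^ j)"
      unfolding prod_norm[symmetric]
      by (intro prod_mono) (auto simp: norm_power[symmetric] intro: norm_triangle_ineq4[THEN order_trans])
    also have "\<dots> \<le> (\<Prod>j\<in>{0<..n}. 1 + norm q ^ j)"
      by (rule prod_mono2) (auto intro: add_nonneg_nonneg)
    also have "\<dots> = (\<Prod>i<n. 1 + norm q ^ Suc i)"
      by (rule prod.reindex_bij_witness[of _ Suc "\<lambda>j. j - 1"]) auto
    also have "\<dots> \<le> C" by (rule C)
    finally show ?thesis .
  qed
  \<comment> \<open>These are the summands of the finite identity with s >= 1. Each exponent is at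
    least n, so the n summands together are at most n |q|^n C.\<close>
  define E where "E n = (\<Sum>s=1..n. (-1) ^ s * (\<Prod>j\<in>{s<..n}. 1 - q ^ j) * q ^ (s * n + s * (s + 1) div 2))" for n
  have "E \<longlonglongrightarrow> 0"
  proof (rule Lim_null_comparison)
    have C0: "C \<ge> 0" using C[of 0] by simp
    have "norm (E n) \<le> real n * norm q ^ n * C" for n
    proof -
      have "norm (E n) \<le> (\<Sum>s=1..n. norm q ^ n * C)"
        unfolding E_def
      proof (rule sum_norm_le)
        fix s assume s: "s \<in> {1..n}"
        have "norm q ^ (s * n + s * (s + 1) div 2) \<le> norm q ^ n"
          using s q by (intro power_decreasing) (auto simp: trans_le_add1)
        then have "norm (\<Prod>j\<in>{s<..n}. 1 - q ^ j) * norm q ^ (s * n + s * (s + 1) div 2) \<le> C * norm q ^ n"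
          using Pb C0 by (intro mult_mono) auto
        then show "norm ((-1) ^ s * (\<Prod>j\<in>{s<..n}. 1 - q ^ j) * q ^ (s * n + s * (s + 1) div 2)) \<le> norm q ^ n * C"
          by (simp add: norm_mult norm_power mult.commute)
      qed
      then show ?thesis by simp
    qed
    then show "\<forall>\<^sub>F n in sequentially. norm (E n) \<le> real n * norm q ^ n * C" by simp
    have "(\<lambda>n. real n * norm q ^ n) \<longlonglongrightarrow> 0"
      using q by (intro powser_times_n_limit_0) simp
    then show "(\<lambda>n. real n * norm q ^ n * C) \<longlonglongrightarrow> 0"
      by (rule tendsto_mult_left_zero)
  qed
  from tendsto_add[OF lim0 this]
  have "(\<lambda>n. (\<Prod>j\<in>{0<..n}. 1 - q ^ j) + E n) \<longlonglongrightarrow> (\<Prod>n. 1 - q ^ Suc n)" by simp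
  moreover have "(\<Prod>j\<in>{0<..n}. 1 - q ^ j) + E n =
     1 + (\<Sum>k=1..n. (-1) ^ k * (q ^ (k * (3 * k - 1) div 2) + q ^ (k * (3 * k + 1) div 2)))" for n
  proof -
    have "{..n} = insert 0 {1..n}" by auto
    then show ?thesis unfolding pentagonal_finite[symmetric] E_def by simp
  qed
  ultimately show "(\<lambda>n. 1 + (\<Sum>k=1..n. (-1) ^ k * (q ^ (k * (3 * k - 1) div 2) + q ^ (k * (3 * k + 1) div 2))))
     \<longlonglongrightarrow> (\<Prod>n. 1 - q ^ Suc n)" by simp
qed

subsection \<open>The Jacobi theta series\<close>

text \<open>With u and v as independent variables, every theta series used here is this one at
  arguments linear in z and \<tau>, up to exponential factors (\<open>theta_term_eq_jterm\<close>).
  Convergence and holomorphy are thus proved once.\<close>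

definition jterm :: "complex \<Rightarrow> complex \<Rightarrow> int \<Rightarrow> complex"
  where "jterm u v m = exp (2 * of_real pi * \<i> * (of_int m * u + (of_int m)\<^sup>2 * v))"

definition jtheta :: "complex \<Rightarrow> complex \<Rightarrow> complex"
  where "jtheta u v = (\<Sum>\<^sub>\<infinity>m\<in>UNIV. jterm u v m)"

definition gauss_bound :: "real \<Rightarrow> real \<Rightarrow> int \<Rightarrow> real"
  where "gauss_bound R \<delta> m = exp (2 * pi * (R * \<bar>of_int m\<bar> - \<delta> * (of_int m)\<^sup>2))"

lemma summable_on_int_abs:
  fixes h :: "nat \<Rightarrow> real"
  assumes "summable h" and "\<And>n. h n \<ge> 0"
  shows "(\<lambda>m::int. h (nat \<bar>m\<bar>)) summable_on UNIV"
proof -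
  have h: "h summable_on UNIV"
    using assms by (simp add: summable_on_UNIV_nonneg_real_iff)
  have 1: "(\<lambda>m::int. h (nat \<bar>m\<bar>)) summable_on range int"
    by (subst summable_on_reindex) (auto simp: inj_on_def o_def h)
  have 2: "(\<lambda>m::int. h (nat \<bar>m\<bar>)) summable_on range (\<lambda>n. - int n)"
    by (subst summable_on_reindex) (auto simp: inj_on_def o_def h)
  have "(UNIV :: int set) = range int \<union> range (\<lambda>n. - int n)"
    by (auto simp: image_iff) (metis int_cases2)
  then show ?thesis
    using summable_on_union[OF 1 2] by simp
qed

text \<open>The weight (1 + |m|)^2 absorbs the factors m and m^2 that differentiation in u and in v
  brings down, so the same majorant serves the series and both partial derivatives.\<close>

lemma gauss_bound_summable:
  assumes "R > 0" "\<delta> > 0"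
  shows "(\<lambda>m. (1 + \<bar>of_int m\<bar>)\<^sup>2 * gauss_bound R \<delta> m) summable_on UNIV"
proof -
  define h where "h n = (1 + real n)\<^sup>2 * exp (2 * pi * (R * real n - \<delta> * (real n)\<^sup>2))" for n
  have "h \<in> O(\<lambda>n. 1 / real n ^ 2)"
    unfolding h_def using assms pi_gt_zero by real_asymp
  moreover have "summable (\<lambda>n. norm (1 / real n ^ 2))"
    using inverse_power_summable[of 2, where ?'a = real] by (simp add: field_simps)
  ultimately have "summable h"
    by (rule summable_comparison_test_bigo[rotated])
  then have "(\<lambda>m::int. h (nat \<bar>m\<bar>)) summable_on UNIV"
    by (rule summable_on_int_abs) (simp add: h_def)
  then show ?thesis
    by (simp add: h_def gauss_bound_def)
qed

lemma norm_jterm_le: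
  assumes "\<bar>Im u\<bar> \<le> R" "\<delta> \<le> Im v"
  shows "norm (jterm u v m) \<le> gauss_bound R \<delta> m"
proof -
  have "of_int m * u + (of_int m)\<^sup>2 * v = of_int m * u + of_int (m\<^sup>2) * v" by simp
  then have "norm (jterm u v m) = exp (2 * pi * (- (of_int m * Im u) - (of_int m)\<^sup>2 * Im v))"
    unfolding jterm_def norm_exp_eq_Re by (simp add: algebra_simps del: of_int_power)
  moreover have "- (of_int m * Im u) \<le> R * \<bar>of_int m\<bar>"
  proof -
    have "- (of_int m * Im u) \<le> \<bar>Im u\<bar> * \<bar>of_int m\<bar>"
      by (metis abs_ge_minus_self abs_mult mult.commute)
    also have "\<dots> \<le> R * \<bar>of_int m\<bar>"
      using assms by (intro mult_right_mono) auto
    finally show ?thesis .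
  qed
  moreover have "\<delta> * (of_int m)\<^sup>2 \<le> (of_int m)\<^sup>2 * Im v"
    using assms by (simp add: mult.commute[of "Im v"] mult.commute[of \<delta>] mult_left_mono)
  ultimately show ?thesis
    unfolding gauss_bound_def by (simp add: mult_left_mono)
qed

lemma jterm_abs_summable:
  assumes "Im v > 0"
  shows "(\<lambda>m. norm (jterm u v m)) summable_on UNIV"
proof (rule Infinite_Sum.abs_summable_on_comparison_test')
  show "(\<lambda>m. (1 + \<bar>of_int m\<bar>)\<^sup>2 * gauss_bound (\<bar>Im u\<bar> + 1) (Im v) m) summable_on UNIV"
    using assms by (intro gauss_bound_summable) auto
  fix m
  have "norm (jterm u v m) \<le> 1 * gauss_bound (\<bar>Im u\<bar> + 1) (Im v) m"
    using norm_jterm_le[of u "\<bar>Im u\<bar> + 1" "Im v" v m] by auto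
  also have "\<dots> \<le> (1 + \<bar>of_int m\<bar>)\<^sup>2 * gauss_bound (\<bar>Im u\<bar> + 1) (Im v) m"
    by (rule mult_right_mono) (auto simp: gauss_bound_def)
  finally show "norm (jterm u v m) \<le> (1 + \<bar>of_int m\<bar>)\<^sup>2 * gauss_bound (\<bar>Im u\<bar> + 1) (Im v) m" .
qed

lemma jterm_has_derivative:
  "((\<lambda>x. jterm (fst x) (snd x) m) has_derivative
    (\<lambda>h. jterm u v m * (2 * of_real pi * \<i> * (of_int m * fst h + (of_int m)\<^sup>2 * snd h)))) (at (u, v) within S)"
proof -
  define L :: "complex \<times> complex \<Rightarrow> complex"
    where "L x = 2 * of_real pi * \<i> * (of_int m * fst x + (of_int m)\<^sup>2 * snd x)" for x
  have "bounded_linear L"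
    unfolding L_def
    by (intro bounded_linear_const_mult bounded_linear_add bounded_linear_fst bounded_linear_snd)
  then have "(L has_derivative L) (at (u, v) within S)"
    by (rule bounded_linear_imp_has_derivative)
  then have "((\<lambda>x. exp (L x)) has_derivative (\<lambda>h. L h * exp (L (u, v)))) (at (u, v) within S)"
    using has_derivative_compose[OF _ has_field_derivative_imp_has_derivative[OF DERIV_exp], of L L]
    by (simp add: mult_ac)
  then show ?thesis by (simp add: jterm_def L_def mult_ac)
qed

lemma jtheta_holomorphic2: "holomorphic2_on (\<lambda>(u, v). jtheta u v) (UNIV \<times> {v. Im v > 0})"
  unfolding holomorphic2_on_def
proof
  fix x0 :: "complex \<times> complex" assume "x0 \<in> UNIV \<times> {v. Im v > 0}"
  then obtain u0 v0 where x0: "x0 = (u0, v0)" "Im v0 > 0" by auto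
  \<comment> \<open>The bounds leave room around the given point, which makes \<open>S\<close> an
    open neighbourhood with one Gaussian majorant; convexity is what termwise differentiation
    requires.\<close>
  define R \<delta> where "R = \<bar>Im u0\<bar> + 1" and "\<delta> = Im v0 / 2"
  have R: "R > 0" and \<delta>: "\<delta> > 0" using x0 by (auto simp: R_def \<delta>_def)
  define S :: "(complex \<times> complex) set" where "S = {u. \<bar>Im u\<bar> < R} \<times> {v. Im v > \<delta>}"
  have S1: "open {u. \<bar>Im u\<bar> < R}" and S2: "convex {u. \<bar>Im u\<bar> < R}"
  proof -
    have eq: "{u. \<bar>Im u\<bar> < R} = {u. Im u < R} \<inter> {u. Im u > -R}" by auto
    show "open {u. \<bar>Im u\<bar> < R}" "convex {u. \<bar>Im u\<bar> < R}"
      unfolding eq by (auto intro!: open_Int open_halfspace_Im_lt open_halfspace_Im_gt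
          convex_Int convex_halfspace_Im_lt convex_halfspace_Im_gt)
  qed
  have opS: "open S" and cvS: "convex S"
    unfolding S_def by (intro open_Times S1 open_halfspace_Im_gt, intro convex_Times S2 convex_halfspace_Im_gt)
  have xS: "x0 \<in> S" using x0 by (auto simp: S_def R_def \<delta>_def)
  \<comment> \<open>The integers are enumerated by \<open>int_decode\<close>, since the M-test and
    termwise differentiation concern series indexed by naturals.\<close>
  define c :: "nat \<Rightarrow> complex" where "c n = of_int (int_decode n)" for n
  define t where "t n x = jterm (fst x) (snd x) (int_decode n)" for n and x :: "complex \<times> complex"
  define ta where "ta n x = t n x * (2 * of_real pi * \<i> * c n)" for n x
  define tb where "tb n x = t n x * (2 * of_real pi * \<i> * (c n)\<^sup>2)" for n x
  define M where "M n = 2 * pi * ((1 + \<bar>of_int (int_decode n)\<bar>)\<^sup>2 * gauss_bound R \<delta> (int_decode n))" for n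
  have sM: "summable M"
  proof -
    have "(\<lambda>n. (1 + \<bar>of_int (int_decode n)\<bar>)\<^sup>2 * gauss_bound R \<delta> (int_decode n)) summable_on UNIV"
      using gauss_bound_summable[OF R \<delta>] bij_int_decode
      by (subst summable_on_reindex_bij_betw[of int_decode UNIV UNIV]) auto
    then show ?thesis
      unfolding M_def by (intro summable_mult summable_on_imp_summable)
  qed
  have nt: "norm (t n x) \<le> gauss_bound R \<delta> (int_decode n)" if "x \<in> S" for n x
    unfolding t_def by (rule norm_jterm_le) (use that in \<open>auto simp: S_def\<close>)
  have gb0: "gauss_bound R \<delta> m \<ge> 0" for m by (simp add: gauss_bound_def)
  have na: "norm (ta n x) \<le> M n" if "x \<in> S" for n x
  proof -
    have "norm (c n) \<le> (1 + \<bar>of_int (int_decode n)\<bar>)\<^sup>2"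
      by (simp add: c_def power2_eq_square algebra_simps)
    then have "norm (t n x) * norm (c n) \<le> gauss_bound R \<delta> (int_decode n) * (1 + \<bar>of_int (int_decode n)\<bar>)\<^sup>2"
      using nt[OF that, of n] by (intro mult_mono gb0) auto
    then show ?thesis
      unfolding M_def ta_def norm_mult by (simp add: mult_ac)
  qed
  have nb: "norm (tb n x) \<le> M n" if "x \<in> S" for n x
  proof -
    have "norm (c n)^2 \<le> (1 + \<bar>of_int (int_decode n)\<bar>)\<^sup>2"
      unfolding c_def by (intro power_mono) auto
    then have "norm (t n x) * norm (c n)^2 \<le> gauss_bound R \<delta> (int_decode n) * (1 + \<bar>of_int (int_decode n)\<bar>)\<^sup>2"
      using nt[OF that, of n] by (intro mult_mono gb0) auto
    then show ?thesis
      unfolding M_def tb_def norm_mult norm_power by (simp add: mult_ac)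
  qed
  define Sa Sb where "Sa x = (\<Sum>n. ta n x)" and "Sb x = (\<Sum>n. tb n x)" for x
  have ula: "uniform_limit S (\<lambda>n x. \<Sum>i<n. ta i x) Sa sequentially"
    unfolding Sa_def by (rule Weierstrass_m_test[OF na sM])
  have ulb: "uniform_limit S (\<lambda>n x. \<Sum>i<n. tb i x) Sb sequentially"
    unfolding Sb_def by (rule Weierstrass_m_test[OF nb sM])
  have tsums: "(\<lambda>n. t n x) sums jtheta (fst x) (snd x)" if "x \<in> S" for x
  proof -
    have "jterm (fst x) (snd x) summable_on UNIV"
      using jterm_abs_summable[of "snd x" "fst x"] that \<delta> by (auto simp: S_def intro: abs_summable_summable)
    then have "(jterm (fst x) (snd x) has_sum jtheta (fst x) (snd x)) UNIV"
      unfolding jtheta_def by (rule has_sum_infsum)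
    then have "((\<lambda>n. t n x) has_sum jtheta (fst x) (snd x)) UNIV"
      unfolding t_def using bij_int_decode by (subst has_sum_reindex_bij_betw[of int_decode UNIV UNIV]) auto
    then show ?thesis by (rule has_sum_imp_sums)
  qed
  have "\<exists>g. \<forall>x\<in>S. (\<lambda>n. t n x) sums (g x) \<and>
      (g has_derivative (\<lambda>h. Sa x * fst h + Sb x * snd h)) (at x within S)"
  proof (rule has_derivative_series[where f = t and
        f' = "\<lambda>n x h. ta n x * fst h + tb n x * snd h", OF cvS _ _ xS tsums[OF xS]])
    fix n x assume "x \<in> S"
    show "(t n has_derivative (\<lambda>h. ta n x * fst h + tb n x * snd h)) (at x within S)"
      using jterm_has_derivative[of "int_decode n" "fst x" "snd x" S]
      by (simp add: t_def[abs_def] ta_def tb_def c_def algebra_simps)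
  next
    \<comment> \<open>The derivatives must converge uniformly as linear maps. Their error is
      controlled by the errors of the two coefficient series, each below e/2.\<close>
    fix e :: real assume e: "e > 0"
    have "\<forall>\<^sub>F n in sequentially. \<forall>x\<in>S. dist (\<Sum>i<n. ta i x) (Sa x) < e/2"
         "\<forall>\<^sub>F n in sequentially. \<forall>x\<in>S. dist (\<Sum>i<n. tb i x) (Sb x) < e/2"
      using ula ulb half_gt_zero[OF e] unfolding uniform_limit_iff by blast+
    then show "\<forall>\<^sub>F n in sequentially. \<forall>x\<in>S. \<forall>h. norm ((\<Sum>i<n. ta i x * fst h + tb i x * snd h)
        - (Sa x * fst h + Sb x * snd h)) \<le> e * norm h"
    proof eventually_elim
      case (elim n)
      show ?case
      proof (intro ballI allI)
        fix x and h :: "complex \<times> complex" assume x: "x \<in> S"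
        have "(\<Sum>i<n. ta i x * fst h + tb i x * snd h) - (Sa x * fst h + Sb x * snd h)
          = ((\<Sum>i<n. ta i x) - Sa x) * fst h + ((\<Sum>i<n. tb i x) - Sb x) * snd h"
          by (simp only: sum.distrib sum_distrib_right[symmetric]) (simp add: algebra_simps)
        also have "norm \<dots> \<le> norm ((\<Sum>i<n. ta i x) - Sa x) * norm (fst h) + norm ((\<Sum>i<n. tb i x) - Sb x) * norm (snd h)"
          by (metis norm_mult norm_triangle_ineq)
        also have "\<dots> \<le> e/2 * norm h + e/2 * norm h"
          using elim x norm_fst_le[of "fst h" "snd h"] norm_snd_le[of "snd h" "fst h"] by (intro add_mono mult_mono) (auto simp: dist_norm less_imp_le intro: e less_imp_le)
        finally show "norm ((\<Sum>i<n. ta i x * fst h + tb i x * snd h)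
        - (Sa x * fst h + Sb x * snd h)) \<le> e * norm h" by (simp add: field_simps)
      qed
    qed
  qed
  then obtain g where g: "\<And>x. x \<in> S \<Longrightarrow> (\<lambda>n. t n x) sums (g x)"
    "\<And>x. x \<in> S \<Longrightarrow> (g has_derivative (\<lambda>h. Sa x * fst h + Sb x * snd h)) (at x within S)" by blast
  have eq: "g x = (\<lambda>(u, v). jtheta u v) x" if "x \<in> S" for x
    using sums_unique2[OF g(1) tsums] that by (auto simp: case_prod_unfold)
  have "((\<lambda>(u, v). jtheta u v) has_derivative (\<lambda>h. Sa x0 * fst h + Sb x0 * snd h)) (at x0 within S)"
    by (rule has_derivative_transform[OF xS _ g(2)[OF xS]]) (simp add: eq)
  then have "((\<lambda>(u, v). jtheta u v) has_derivative (\<lambda>h. Sa x0 * fst h + Sb x0 * snd h)) (at x0)"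
    using at_within_open[OF xS opS] by simp
  then show "\<exists>a b. ((\<lambda>(u, v). jtheta u v) has_derivative (\<lambda>(h, k). a * h + b * k)) (at x0)"
    by (auto simp: case_prod_unfold)
qed

subsection \<open>The branching identity\<close>

text \<open>The coefficients \<alpha> of the linear and \<gamma> of the quadratic exponent are kept
  independent, because rescaling z and \<tau> changes them differently; \<alpha> = 0 gives a series
  in \<tau> alone.\<close>

definition theta_term :: "real \<Rightarrow> real \<Rightarrow> real \<Rightarrow> complex \<Rightarrow> complex \<Rightarrow> int \<Rightarrow> complex"
  where "theta_term \<alpha> \<beta> \<gamma> z \<tau> m = epow (\<alpha> * (of_int m + \<beta>)) z * epow (\<gamma> * (of_int m + \<beta>)\<^sup>2) \<tau>"

lemma epow_add: "epow (x + y) z = epow x z * epow y z"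
  by (simp add: epow_def exp_add[symmetric] algebra_simps)

lemma epow_nonzero [simp]: "epow x z \<noteq> 0"
  by (simp add: epow_def)

lemma epow_0_right [simp]: "epow x 0 = 1"
  by (simp add: epow_def)

lemma epow_divide: "epow x (z / of_real c) = epow (x / c) z"
  by (simp add: epow_def)

lemma theta_term_eq_jterm:
  "theta_term \<alpha> \<beta> \<gamma> z \<tau> m = epow (\<alpha> * \<beta>) z * epow (\<gamma> * \<beta>\<^sup>2) \<tau> *
     jterm (of_real \<alpha> * z + of_real (2 * \<gamma> * \<beta>) * \<tau>) (of_real \<gamma> * \<tau>) m"
  unfolding theta_term_def epow_def jterm_def exp_add[symmetric]
  by (rule arg_cong[where f = exp]) (simp add: algebra_simps power2_eq_square)

lemma theta_term_abs_summable:
  assumes "\<gamma> > 0" "Im \<tau> > 0"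
  shows "(\<lambda>m. norm (theta_term \<alpha> \<beta> \<gamma> z \<tau> m)) summable_on UNIV"
  unfolding theta_term_eq_jterm norm_mult
  using assms by (intro summable_on_cmult_right jterm_abs_summable) simp

lemma infsum_theta_term:
  "infsum (theta_term \<alpha> \<beta> \<gamma> z \<tau>) UNIV = epow (\<alpha> * \<beta>) z * epow (\<gamma> * \<beta>\<^sup>2) \<tau> *
     jtheta (of_real \<alpha> * z + of_real (2 * \<gamma> * \<beta>) * \<tau>) (of_real \<gamma> * \<tau>)"
  unfolding theta_term_eq_jterm[abs_def] jtheta_def by (rule infsum_cmult_right')

lemma Theta_eq: "Theta r s z \<tau> = infsum (theta_term (of_int s) (of_int r / (2 * of_int s)) (of_int s) z \<tau>) UNIV"
  by (simp add: Theta_def theta_term_def[abs_def])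

lemma theta2_eq: "theta2 z \<tau> = infsum (theta_term 1 (1/2) (1/2) z \<tau>) UNIV"
  by (simp add: theta2_def theta_term_def[abs_def])

section \<open>Double series over congruence classes\<close>

lemma has_sum_product:
  fixes f :: "'a \<Rightarrow> complex" and g :: "'b \<Rightarrow> complex"
  assumes f: "(\<lambda>x. norm (f x)) summable_on A" and g: "(\<lambda>x. norm (g x)) summable_on B"
  shows "((\<lambda>(x, y). f x * g y) has_sum (infsum f A * infsum g B)) (A \<times> B)"
proof (rule has_sum_SigmaI)
  show "((\<lambda>y. (\<lambda>(x, y). f x * g y) (x, y)) has_sum (f x * infsum g B)) B" for x
    using g by (auto intro!: has_sum_cmult_right has_sum_infsum abs_summable_summable)
  show "((\<lambda>x. f x * infsum g B) has_sum (infsum f A * infsum g B)) A"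
    using f by (auto intro!: has_sum_cmult_left has_sum_infsum abs_summable_summable)
  have "(\<lambda>z. norm ((\<lambda>(x, y). f x * g y) z)) summable_on (A \<times> B)"
    unfolding Infinite_Sum.abs_summable_on_Sigma_iff
    using f g by (auto simp: norm_mult infsum_cmult_right' abs_mult infsum_nonneg
        intro!: summable_on_cmult_right summable_on_cmult_left)
  then show "(\<lambda>(x, y). f x * g y) summable_on (A \<times> B)"
    by (rule abs_summable_summable)
qed

lemma abs_summable_residue:
  fixes f :: "int \<Rightarrow> complex" and N c :: int
  assumes "(\<lambda>x. norm (f x)) summable_on UNIV" "N > 0"
  shows "(\<lambda>m. norm (f (N * m + c))) summable_on UNIV"
proof -
  have "inj (\<lambda>m. N * m + c)" using assms(2) by (auto simp: inj_on_def)
  then have "(\<lambda>m. norm (f (N * m + c))) summable_on UNIV \<longleftrightarrow> (\<lambda>m. norm (f m)) summable_on range (\<lambda>m. N * m + c)"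
    by (subst summable_on_reindex) (auto simp: o_def)
  then show ?thesis
    using assms(1) by (auto intro: summable_on_subset_banach)
qed

definition residue_sum :: "(int \<Rightarrow> complex) \<Rightarrow> int \<Rightarrow> int \<Rightarrow> complex"
  where "residue_sum f N c = (\<Sum>\<^sub>\<infinity>m\<in>UNIV. f (N * m + c))"

lemma residue_sum_shift: "residue_sum f N (N + c) = residue_sum f N c"
  unfolding residue_sum_def
  by (rule infsum_reindex_bij_witness[of _ "\<lambda>m. m - 1" "\<lambda>m. m + 1"]) (auto simp: algebra_simps)

text \<open>The residue c of x determines the residue e c of y, so on each class the two indices run
  independently and the double sum factors.\<close>

lemma has_sum_congruence_class:
  fixes f g :: "int \<Rightarrow> complex" and N e :: int
  assumes f: "(\<lambda>x. norm (f x)) summable_on UNIV" and g: "(\<lambda>x. norm (g x)) summable_on UNIV" and N: "N > 0"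
  shows "((\<lambda>(x, y). f x * g y) has_sum (\<Sum>c\<in>{0..<N}. residue_sum f N c * residue_sum g N (e * c)))
     {(x, y). N dvd y - e * x}"
proof -
  have eq: "{(x, y). N dvd y - e * x} = (\<Union>c\<in>{0..<N}. {(x, y). x mod N = c \<and> N dvd y - e * c})"
  proof -
    have "N dvd y - e * x \<longleftrightarrow> N dvd y - e * (x mod N)" for x y
    proof -
      define d t where "d = x div N" and "t = x mod N"
      have "x = N * d + t" by (simp add: d_def t_def)
      then have *: "y - e * t = y - e * x + N * (e * d)" by (simp add: algebra_simps)
      show ?thesis by (simp only: t_def[symmetric] * dvd_add_left_iff[OF dvd_triv_left])
    qed
    then show ?thesis using N by auto
  qed
  show ?thesis unfolding eq
  proof (rule sum_has_sum)
    fix c assume c: "c \<in> {0..<N}"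
    have "((\<lambda>(m, k). f (N * m + c) * g (N * k + e * c)) has_sum
        (residue_sum f N c * residue_sum g N (e * c))) (UNIV \<times> UNIV)"
      unfolding residue_sum_def by (intro has_sum_product abs_summable_residue f g N)
    also have "?this \<longleftrightarrow> ((\<lambda>(x, y). f x * g y) has_sum
        (residue_sum f N c * residue_sum g N (e * c))) {(x, y). x mod N = c \<and> N dvd y - e * c}"
      by (rule has_sum_reindex_bij_witness[where j = "\<lambda>(m, k). (N * m + c, N * k + e * c)"
            and i = "\<lambda>(x, y). (x div N, (y - e * c) div N)"])
         (use c N in auto)
    finally show "((\<lambda>(x, y). f x * g y) has_sum
        (residue_sum f N c * residue_sum g N (e * c))) {(x, y). x mod N = c \<and> N dvd y - e * c}" .
  qed auto
qed

text \<open>The left side is the sum of A c (B c - B (-c)). The second factor is odd and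
  2L-periodic, hence zero where c and -c agree modulo 2L; adding the terms of c and -c then
  antisymmetrizes A as well.\<close>

lemma sum_antisym_residues:
  fixes A B :: "int \<Rightarrow> 'a::comm_ring_1"
  assumes A: "\<And>c. A (2 * L + c) = A c" and B: "\<And>c. B (2 * L + c) = B c" and L: "L > 0"
  shows "(\<Sum>c\<in>{0..<2*L}. A c * B c) - (\<Sum>c\<in>{0..<2*L}. A c * B (- c))
    = (\<Sum>i=1..L-1. (A i - A (- i)) * (B i - B (- i)))"
proof -
  define F where "F c = A c * (B c - B (- c))" for c
  have "{0..<2*L} = insert 0 (insert L ({1..L-1} \<union> {L+1..<2*L}))"
    using L by auto
  then have "(\<Sum>c\<in>{0..<2*L}. F c) = F 0 + F L + ((\<Sum>c\<in>{1..L-1}. F c) + (\<Sum>c\<in>{L+1..<2*L}. F c))"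
    using L by (simp, subst sum.union_disjoint) auto
  moreover have "F 0 = 0" "F L = 0"
    using B[of "- L"] by (simp_all add: F_def)
  moreover have "(\<Sum>c\<in>{L+1..<2*L}. F c) = (\<Sum>i\<in>{1..L-1}. F (- i))"
  proof (rule sum.reindex_bij_witness[of _ "\<lambda>i. 2 * L - i" "\<lambda>c. 2 * L - c"])
    fix c assume "c \<in> {L+1..<2*L}"
    show "F (- (2 * L - c)) = F c"
      using A[of "c - 2 * L"] B[of "c - 2 * L"] B[of "-c"] by (simp add: F_def)
  qed auto
  ultimately have "(\<Sum>c\<in>{0..<2*L}. F c) = (\<Sum>i\<in>{1..L-1}. F i + F (- i))"
    by (simp add: sum.distrib)
  also have "\<dots> = (\<Sum>i=1..L-1. (A i - A (- i)) * (B i - B (- i)))"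
    by (simp add: F_def algebra_simps)
  finally show ?thesis
    by (simp add: F_def sum_subtractf[symmetric] right_diff_distrib)
qed

lemma epow_eqI: "x = x' \<Longrightarrow> y = y' \<Longrightarrow> epow x z * epow y \<tau> = epow x' z * epow y' \<tau>"
  by simp

text \<open>The mixed terms p' x y / (\<Delta> p') and - p x y / (\<Delta> p), with \<Delta> = p +
  p', cancel, and 1/p + 1/p' = \<Delta>/(p p') matches the squares.\<close>

lemma rotation_identity:
  fixes p p' x y :: real
  assumes "p > 0" "p' > 0"
  shows "(x + p' * y)\<^sup>2 / (2 * (p + p') * p') + (x - p * y)\<^sup>2 / (2 * (p + p') * p)
     = x\<^sup>2 / (2 * p * p') + y\<^sup>2 / 2"
proof -
  have "p + p' \<noteq> 0" "p \<noteq> 0" "p' \<noteq> 0" using assms by auto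
  then show ?thesis
    by (simp add: divide_simps) algebra
qed

section \<open>The product of the numerator with theta_2\<close>

context
  fixes p p' \<Delta> r s :: int and z \<tau> :: complex
  assumes p: "p > 0" and p': "p' > 0" and \<Delta>: "\<Delta> = p + p'" and rs: "odd (r + s)" and \<tau>: "Im \<tau> > 0"
begin

text \<open>Summing over one residue class modulo \<Delta> of the index yields one theta function in
  the numerator of \<open>ch_D\<close>, the residue being the label i; likewise
  \<open>vir_term\<close> for \<open>ch_V\<close>.\<close>

definition sl2_term where "sl2_term = theta_term (1/2) (- (\<Delta> * s) / (2 * p')) (p' / (2 * \<Delta>)) z \<tau>"
definition vir_term where "vir_term = theta_term 0 (- (\<Delta> * r) / (2 * p)) (p / (2 * \<Delta>)) 0 \<tau>"

lemma sl2_term_summable: "(\<lambda>x. norm (sl2_term x)) summable_on UNIV" and vir_term_summable: "(\<lambda>x. norm (vir_term x)) summable_on UNIV"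
  unfolding sl2_term_def vir_term_def using p p' \<Delta> \<tau> by (auto intro!: theta_term_abs_summable)

lemma Theta_eq_residue_sum_sl2:
  "Theta (2 * p' * i - \<Delta> * s) (\<Delta> * p') (z / (2 * of_int p')) (\<tau> / 2) = residue_sum sl2_term \<Delta> i"
  unfolding Theta_eq residue_sum_def
proof (rule infsum_cong)
  fix m :: int
  have nz: "real_of_int p' \<noteq> 0" "real_of_int \<Delta> \<noteq> 0" using p p' \<Delta> by auto
  have z2: "z / (2 * of_int p') = z / of_real (2 * p')" "\<tau> / 2 = \<tau> / of_real 2" by simp_all
  show "theta_term (of_int (\<Delta> * p')) (of_int (2 * p' * i - \<Delta> * s) / (2 * of_int (\<Delta> * p'))) (of_int (\<Delta> * p'))
         (z / (2 * of_int p')) (\<tau> / 2) m = sl2_term (\<Delta> * m + i)"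
    unfolding theta_term_def sl2_term_def z2 epow_divide
    by (rule epow_eqI) (use nz in \<open>simp_all add: field_simps power2_eq_square\<close>)
qed

lemma Theta_eq_residue_sum_vir:
  "Theta (2 * p * i - \<Delta> * r) (\<Delta> * p) 0 (\<tau> / 2) = residue_sum vir_term \<Delta> i"
  unfolding Theta_eq residue_sum_def
proof (rule infsum_cong)
  fix m :: int
  have nz: "real_of_int p \<noteq> 0" "real_of_int \<Delta> \<noteq> 0" using p p' \<Delta> by auto
  have z2: "\<tau> / 2 = \<tau> / of_real 2" by simp_all
  show "theta_term (of_int (\<Delta> * p)) (of_int (2 * p * i - \<Delta> * r) / (2 * of_int (\<Delta> * p))) (of_int (\<Delta> * p))
         0 (\<tau> / 2) m = vir_term (\<Delta> * m + i)"
    unfolding theta_term_def vir_term_def z2 epow_divide epow_0_right mult_1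
    by (rule arg_cong[where f = "\<lambda>x. epow x \<tau>"]) (use nz in \<open>simp add: field_simps power2_eq_square\<close>)
qed

text \<open>The sign e selects the term of the numerator. Putting e also into the second index keeps
  the shift of \<open>vir_term\<close> the same for both terms, so that e survives only in the
  congruence.\<close>

lemma Theta_mult_theta2:
  assumes e: "e = 1 \<or> e = -1"
  shows "Theta (e * p' * r - p * s) (p * p') (z / (2 * of_int p')) (\<tau>/2) * theta2 (z/2) \<tau>
     = (\<Sum>c\<in>{0..<\<Delta>}. residue_sum sl2_term \<Delta> c * residue_sum vir_term \<Delta> (e * c))"
proof -
  have \<Delta>0: "\<Delta> > 0" using p p' \<Delta> by simp
  \<comment> \<open>The half-integers e r/2, s/2 and 1/2 occurring in the rotated coordinates add up
    to this number, an integer because r + s is odd.\<close>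
  define h where "h = (e * r + s + 1) div 2"
  have h: "2 * h = e * r + s + 1" using e rs unfolding h_def
    by (intro dvd_mult_div_cancel) auto
  have hr: "real_of_int h = (real_of_int e * of_int r + of_int s + 1) / 2"
    using h by (metis (mono_tags) nonzero_mult_div_cancel_left of_int_1 of_int_add of_int_mult of_int_numeral zero_neq_numeral)
  define a where "a = theta_term (of_int (p * p')) (of_int (e * p' * r - p * s) / (2 * of_int (p * p')))
      (of_int (p * p')) (z / (2 * of_int p')) (\<tau> / 2)"
  define b where "b = theta_term 1 (1/2) (1/2) (z/2) \<tau>"
  have ab: "a m * b n = sl2_term (p * m + n + h) * vir_term (e * (n - p' * m + h))" for m n
  proof -
    have nz: "real_of_int p \<noteq> 0" "real_of_int p' \<noteq> 0" "real_of_int \<Delta> \<noteq> 0" using p p' \<Delta> by auto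
    have z2: "z / (2 * of_int p') = z / of_real (2 * p')" "\<tau> / 2 = \<tau> / of_real 2" "z / 2 = z / of_real 2"
      by simp_all
    define P P' D where PD: "P = real_of_int p" "P' = real_of_int p'" "D = real_of_int \<Delta>"
    have PP: "P > 0" "P' > 0" "D = P + P'" using p p' \<Delta> by (auto simp: PD)
    define x where "x = P * P' * m + (e * P' * r - P * s) / 2"
    define y where "y = of_int n + (1/2 :: real)"
    \<comment> \<open>\<open>X\<close> and \<open>Y\<close> are the shifted indices that appear in
      \<open>sl2_term\<close> and \<open>vir_term\<close>; they are x + p'y and x - py divided by p'
      and by -e p, using e^2 = 1.\<close>
    define X where "X = of_int (p * m + n + h) + - (\<Delta> * s) / (2 * p')"
    define Y where "Y = of_int (e * (n - p' * m + h)) + - (\<Delta> * r) / (2 * p)"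
    have X: "X = (x + P' * y) / P'"
      using PP unfolding X_def x_def y_def of_int_add of_int_mult hr PD[symmetric] of_int_minus
      by (simp add: field_simps)
    have Y: "Y = - e * (x - P * y) / P"
      using PP e unfolding Y_def x_def y_def of_int_add of_int_mult of_int_diff hr PD[symmetric] of_int_minus
      by (auto simp: field_simps)
    have x1: "of_int m + of_int (e * p' * r - p * s) / (2 * of_int (p * p')) = x / (P * P')"
      using PP by (simp add: x_def PD[symmetric] field_simps)
    have Y2: "Y\<^sup>2 = (x - P * y)\<^sup>2 / P\<^sup>2"
      using e unfolding Y by (auto simp: power_divide power2_commute)
    have "a m * b n = epow (x / (2 * P') + y / 2) z * epow (x\<^sup>2 / (2 * P * P') + y\<^sup>2 / 2) \<tau>"
      unfolding a_def b_def theta_term_def x1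
      unfolding z2 epow_divide y_def[symmetric] epow_add of_int_mult PD[symmetric]
      using PP by (simp add: power2_eq_square mult_ac)
    also have "\<dots> = epow (X / 2) z * epow (P' / (2 * D) * X\<^sup>2 + P / (2 * D) * Y\<^sup>2) \<tau>"
    proof (rule epow_eqI)
      show "x / (2 * P') + y / 2 = X / 2" using PP by (simp add: X field_simps)
      have "P' / (2 * D) * X\<^sup>2 = (x + P' * y)\<^sup>2 / (2 * (P + P') * P')"
        using PP by (simp add: X power_divide power2_eq_square)
      moreover have "P / (2 * D) * Y\<^sup>2 = (x - P * y)\<^sup>2 / (2 * (P + P') * P)"
        using PP by (simp add: Y2 power2_eq_square[of P])
      ultimately show "x\<^sup>2 / (2 * P * P') + y\<^sup>2 / 2 = P' / (2 * D) * X\<^sup>2 + P / (2 * D) * Y\<^sup>2"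
        using rotation_identity[of P P' x y] PP by simp
    qed
    also have "\<dots> = sl2_term (p * m + n + h) * vir_term (e * (n - p' * m + h))"
      unfolding sl2_term_def vir_term_def theta_term_def X_def[symmetric] Y_def[symmetric] PD[symmetric] epow_add
      by (simp add: PD(3))
    finally show ?thesis .
  qed
  have "(\<lambda>x. norm (a x)) summable_on UNIV" "(\<lambda>x. norm (b x)) summable_on UNIV"
    unfolding a_def b_def using p p' \<tau> by (auto intro!: theta_term_abs_summable)
  then have "((\<lambda>(m, n). a m * b n) has_sum (infsum a UNIV * infsum b UNIV)) (UNIV \<times> UNIV)"
    by (rule has_sum_product)
  also have "?this \<longleftrightarrow> ((\<lambda>(x, y). sl2_term x * vir_term y) has_sum (infsum a UNIV * infsum b UNIV)) {(x, y). \<Delta> dvd y - e * x}"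
  \<comment> \<open>For the image pair (T, T') one has T - e T' = \<Delta> m, which recovers m by
    division and then n from T; it also shows that the image is exactly the congruence T' = e T
    modulo \<Delta>.\<close>
  proof (rule has_sum_reindex_bij_witness[where
        j = "\<lambda>(m, n). (p * m + n + h, e * (n - p' * m + h))" and
        i = "\<lambda>(x, y). ((x - e * y) div \<Delta>, x - p * ((x - e * y) div \<Delta>) - h)"], goal_cases)
    case (1 t)
    have "p * m + n + h - e * (e * (n - p' * m + h)) = \<Delta> * m" for m n
      using e by (auto simp: \<Delta> algebra_simps)
    with \<Delta>0 show ?case by (cases t) simp
  next
    case (2 t)
    have "e * (n - p' * m + h) - e * (p * m + n + h) = \<Delta> * (- e * m)" for m n
      by (simp add: \<Delta> algebra_simps)
    then show ?case by (cases t) simp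
  next
    case (3 t)
    obtain x y where t: "t = (x, y)" by (cases t)
    with 3 obtain k where k: "y - e * x = \<Delta> * k" by auto
    have xy: "x - e * y = \<Delta> * (- e * k)" using e k by (auto simp: algebra_simps)
    have d: "(x - e * y) div \<Delta> = - e * k"
      unfolding xy by (rule nonzero_mult_div_cancel_left) (use \<Delta>0 in simp)
    show ?case unfolding t prod.case d using e k by (auto simp: \<Delta> algebra_simps)
  next
    case (5 t)
    then show ?case by (cases t) (simp add: ab)
  qed auto
  finally have "((\<lambda>(x, y). sl2_term x * vir_term y) has_sum (infsum a UNIV * infsum b UNIV)) {(x, y). \<Delta> dvd y - e * x}" .
  then show ?thesis
    using has_sum_congruence_class[OF sl2_term_summable vir_term_summable \<Delta>0, of e]
    unfolding Theta_eq theta2_eq a_def[symmetric] b_def[symmetric] by (rule has_sum_unique)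
qed

lemma branching_identity:
  assumes "even \<Delta>"
  shows "(Theta (p' * r - p * s) (p * p') (z / (2 * of_int p')) (\<tau>/2)
     - Theta (- p' * r - p * s) (p * p') (z / (2 * of_int p')) (\<tau>/2)) * theta2 (z/2) \<tau> =
   (\<Sum>i = 1..\<Delta> div 2 - 1.
     (Theta (2 * p' * i - \<Delta> * s) (\<Delta> * p') (z / (2 * of_int p')) (\<tau>/2)
     - Theta (- 2 * p' * i - \<Delta> * s) (\<Delta> * p') (z / (2 * of_int p')) (\<tau>/2)) *
     (Theta (2 * p * i - \<Delta> * r) (\<Delta> * p) 0 (\<tau>/2)
     - Theta (- 2 * p * i - \<Delta> * r) (\<Delta> * p) 0 (\<tau>/2)))"
proof -
  define L where "L = \<Delta> div 2"
  have L: "\<Delta> = 2 * L" "L > 0" using assms p p' \<Delta> by (auto simp: L_def)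
  have "(\<Sum>c\<in>{0..<2*L}. residue_sum sl2_term \<Delta> c * residue_sum vir_term \<Delta> c)
     - (\<Sum>c\<in>{0..<2*L}. residue_sum sl2_term \<Delta> c * residue_sum vir_term \<Delta> (- c))
    = (\<Sum>i=1..L-1. (residue_sum sl2_term \<Delta> i - residue_sum sl2_term \<Delta> (- i)) * (residue_sum vir_term \<Delta> i - residue_sum vir_term \<Delta> (- i)))"
    by (rule sum_antisym_residues) (simp_all add: L(2) L(1)[symmetric] residue_sum_shift)
  then show ?thesis
    using Theta_mult_theta2[of 1] Theta_mult_theta2[of "-1"] Theta_eq_residue_sum_sl2[of "- _"] Theta_eq_residue_sum_vir[of "- _"]
    by (simp add: left_diff_distrib Theta_eq_residue_sum_sl2 Theta_eq_residue_sum_vir L(1)[symmetric] L_def[symmetric])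
qed

end

subsection \<open>The quintuple product identity\<close>

definition neg1pow :: "int \<Rightarrow> complex"
  where "neg1pow n = (if even n then 1 else -1)"

text \<open>The sign splits the sum by parity. The odd class is represented by -1 rather than 1 so
  that it matches the labels -2 and -10 of the theta functions for theta_1 and eta.\<close>

lemma has_sum_alternating:
  fixes f :: "int \<Rightarrow> complex"
  assumes f: "(\<lambda>n. norm (f n)) summable_on UNIV"
  shows "((\<lambda>n. neg1pow n * f n) has_sum (residue_sum f 2 0 - residue_sum f 2 (-1))) UNIV"
proof -
  have r: "((\<lambda>m. f (2 * m + c)) has_sum residue_sum f 2 c) UNIV" for c
    unfolding residue_sum_def
    by (rule has_sum_infsum[OF abs_summable_summable[OF abs_summable_residue[OF f]]]) simp
  have 10: "((\<lambda>m. f (2 * m + 0)) has_sum residue_sum f 2 0) UNIV \<longleftrightarrow>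
      ((\<lambda>n. neg1pow n * f n) has_sum residue_sum f 2 0) {n. even n}"
    by (rule has_sum_reindex_bij_witness[where j = "\<lambda>m. 2 * m" and i = "\<lambda>n. n div 2"])
       (auto simp: neg1pow_def)
  note 1 = iffD1[OF 10 r[of 0]]
  have 20: "((\<lambda>m. - f (2 * m + - 1)) has_sum - residue_sum f 2 (-1)) UNIV \<longleftrightarrow>
      ((\<lambda>n. neg1pow n * f n) has_sum - residue_sum f 2 (-1)) {n. odd n}"
    by (rule has_sum_reindex_bij_witness[where j = "\<lambda>m. 2 * m - 1" and i = "\<lambda>n. (n + 1) div 2"])
       (auto simp: neg1pow_def, presburger)
  note 2 = iffD1[OF 20 has_sum_uminusI[OF r[of "-1"]]]
  have "{n::int. even n} \<union> {n. odd n} = UNIV" "{n::int. even n} \<inter> {n. odd n} = {}" by blast+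
  with has_sum_Un_disjoint[OF 1 2] show ?thesis by simp
qed

section \<open>Eta and theta_1 as differences of theta functions\<close>

lemma filterlim_symmetric_interval:
  "filterlim (\<lambda>n. {- int n..int n}) (finite_subsets_at_top UNIV) sequentially"
  unfolding filterlim_finite_subsets_at_top
proof (intro allI impI)
  fix X :: "int set" assume "finite X \<and> X \<subseteq> UNIV"
  then obtain b where b: "\<And>x. x \<in> X \<Longrightarrow> \<bar>x\<bar> \<le> b"
    using bdd_above_finite[of "abs ` X"] by (auto simp: bdd_above_def)
  have "X \<subseteq> {- int n..int n}" if "n \<ge> nat b" for n
  proof
    fix x assume "x \<in> X"
    with b[of x] that show "x \<in> {- int n..int n}" by (simp add: abs_le_iff) linarith
  qed
  then show "\<forall>\<^sub>F n in sequentially. finite {- int n..int n} \<and> X \<subseteq> {- int n..int n} \<and> {- int n..int n} \<subseteq> UNIV"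
    unfolding eventually_sequentially by blast
qed

lemma norm_epow_less_1: "Im \<tau> > 0 \<Longrightarrow> norm (epow 1 \<tau>) < 1"
  by (simp add: epow_def norm_exp_eq_Re)

lemma epow_of_nat: "epow (of_nat n) z = epow 1 z ^ n"
  by (simp add: epow_def exp_of_nat_mult[symmetric] mult_ac)

lemma dedekind_eta_nonzero:
  assumes "Im \<tau> > 0"
  shows "dedekind_eta \<tau> \<noteq> 0"
  using pentagonal_number(2)[OF norm_epow_less_1[OF assms]]
  unfolding dedekind_eta_def epow_of_nat by simp

lemma sum_symmetric_interval:
  fixes f :: "int \<Rightarrow> 'a::comm_monoid_add"
  shows "(\<Sum>l\<in>{- int n..int n}. f l) = f 0 + (\<Sum>k=1..n. f (- int k) + f (int k))"
proof (induction n)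
  case (Suc n)
  have "{- int (Suc n)..int (Suc n)} = insert (- int (Suc n)) (insert (int (Suc n)) {- int n..int n})"
    by auto
  with Suc show ?case by (simp add: add_ac del: of_nat_Suc)
qed simp

text \<open>The unordered sum converges absolutely, so its value may be computed along the intervals
  from -n to n, whose partial sums are the finite sums in Euler's theorem.\<close>

lemma dedekind_eta_has_sum:
  assumes "Im \<tau> > 0"
  shows "((\<lambda>l. neg1pow l * theta_term 0 (1/6) (3/2) 0 \<tau> l) has_sum dedekind_eta \<tau>) UNIV"
proof -
  define q where "q = epow 1 \<tau>"
  define f where "f l = neg1pow l * theta_term 0 (1/6) (3/2) 0 \<tau> l" for l
  \<comment> \<open>Completing the square gives (3/2)(l + 1/6)^2 = 1/24 + l(3l + 1)/2: the constant
    is the prefactor of eta, and l = k, l = -k give the two pentagonal exponents.\<close>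
  have tt: "theta_term 0 (1/6) (3/2) 0 \<tau> l = epow (1/24) \<tau> * q ^ e"
    if "int (2 * e) = l * (3 * l + 1)" for l e
  proof -
    have "2 * real e = real_of_int l * (3 * real_of_int l + 1)"
      using arg_cong[OF that, of real_of_int] by simp
    then have "3/2 * (of_int l + 1/6)\<^sup>2 = 1/24 + real e"
      by (simp add: power2_eq_square algebra_simps)
    then show ?thesis
      by (simp only: theta_term_def q_def epow_of_nat[symmetric] epow_add) (simp add: epow_def)
  qed
  have ev: "2 * (k * (3 * k - 1) div 2) = k * (3 * k - 1)" "2 * (k * (3 * k + 1) div 2) = k * (3 * k + 1)" for k :: nat
    by (intro dvd_mult_div_cancel; auto)+
  have fm: "f (- int k) = (-1) ^ k * (epow (1/24) \<tau> * q ^ (k * (3 * k - 1) div 2))" if "k \<ge> 1" for k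
  proof -
    have "int (2 * (k * (3 * k - 1) div 2)) = (- int k) * (3 * (- int k) + 1)"
      using that by (simp only: ev) (simp add: algebra_simps of_nat_diff)
    then show ?thesis unfolding f_def by (simp only: tt) (simp add: neg1pow_def)
  qed
  have fp: "f (int k) = (-1) ^ k * (epow (1/24) \<tau> * q ^ (k * (3 * k + 1) div 2))" for k
  proof -
    have "int (2 * (k * (3 * k + 1) div 2)) = int k * (3 * int k + 1)"
      by (simp only: ev) (simp add: algebra_simps)
    then show ?thesis unfolding f_def by (simp only: tt) (simp add: neg1pow_def)
  qed
  have part: "(\<Sum>l\<in>{- int n..int n}. f l) = epow (1/24) \<tau> *
      (1 + (\<Sum>k=1..n. (-1) ^ k * (q ^ (k * (3 * k - 1) div 2) + q ^ (k * (3 * k + 1) div 2))))" for n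
  proof -
    have "(\<Sum>k=1..n. f (- int k) + f (int k)) = (\<Sum>k=1..n. epow (1/24) \<tau> *
        ((-1) ^ k * (q ^ (k * (3 * k - 1) div 2) + q ^ (k * (3 * k + 1) div 2))))"
      by (intro sum.cong refl) (simp only: atLeastAtMost_iff fm fp ring_distribs mult.left_commute)
    moreover have "f 0 = epow (1/24) \<tau>" using fp[of 0] by simp
    ultimately show ?thesis
      by (simp only: sum_symmetric_interval sum_distrib_left[symmetric] distrib_left[of _ 1] mult_1_right)
  qed
  have "(\<lambda>n. \<Sum>l\<in>{- int n..int n}. f l) \<longlonglongrightarrow> dedekind_eta \<tau>"
    unfolding part dedekind_eta_def epow_of_nat q_def
    by (intro tendsto_mult tendsto_const pentagonal_number(1) norm_epow_less_1 assms)
  moreover have s: "f summable_on UNIV"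
    using has_sum_alternating[OF theta_term_abs_summable[OF _ assms, of "3/2"]]
    unfolding f_def by (auto simp: summable_on_def)
  then have "(\<lambda>n. \<Sum>l\<in>{- int n..int n}. f l) \<longlonglongrightarrow> infsum f UNIV"
    using filterlim_compose[OF _ filterlim_symmetric_interval] has_sum_infsum[OF s]
    unfolding has_sum_def by blast
  ultimately have "infsum f UNIV = dedekind_eta \<tau>"
    by (rule LIMSEQ_unique[rotated])
  moreover have "f = (\<lambda>l. neg1pow l * theta_term 0 (1/6) (3/2) 0 \<tau> l)"
    by (rule ext) (rule f_def)
  ultimately show ?thesis using has_sum_infsum[OF s] by simp
qed

lemma dedekind_eta_eq_Theta:
  assumes "Im \<tau> > 0"
  shows "dedekind_eta \<tau> = Theta 2 12 0 (\<tau>/2) - Theta (-10) 12 0 (\<tau>/2)"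
proof -
  have t2: "\<tau> / 2 = \<tau> / of_real 2" by simp
  have "Theta 2 12 0 (\<tau>/2) = residue_sum (theta_term 0 (1/6) (3/2) 0 \<tau>) 2 0"
       "Theta (-10) 12 0 (\<tau>/2) = residue_sum (theta_term 0 (1/6) (3/2) 0 \<tau>) 2 (-1)"
    unfolding Theta_eq residue_sum_def theta_term_def t2 epow_divide epow_0_right mult_1
    by (intro infsum_cong arg_cong[where f = "\<lambda>x. epow x \<tau>"]; simp add: power2_eq_square field_simps)+
  then show ?thesis
    using has_sum_unique[OF dedekind_eta_has_sum[OF assms]
        has_sum_alternating[OF theta_term_abs_summable[OF _ assms, of "3/2"]]] by simp
qed

lemma theta1_eq_Theta:
  assumes "Im \<tau> > 0"
  shows "\<i> * theta1 z \<tau> = Theta 2 4 (z/2) (\<tau>/2) - Theta (-2) 4 (z/2) (\<tau>/2)"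
proof -
  have t2: "\<tau> / 2 = \<tau> / of_real 2" "z / 2 = z / of_real 2" by simp_all
  \<comment> \<open>Shifting z by 1/2 produces exp(pi i (n + 1/2)) = i (-1)^n. This i, the sign in
    \<open>theta1_def\<close> and the factor i in the statement multiply to 1.\<close>
  have "epow (of_int n + 1/2) (1/2) = \<i> * neg1pow n" for n
  proof -
    have "epow (of_int n + 1/2) (1/2) = exp (of_int n * (of_real pi * \<i>)) * exp (of_real pi * \<i> / 2)"
      by (simp add: epow_def exp_add[symmetric] algebra_simps)
    also have "exp (of_int n * (of_real pi * \<i>)) = neg1pow n"
      by (auto simp: neg1pow_def exp_eq_1 elim!: evenE oddE)
         (auto simp: exp_add algebra_simps)
    also have "exp (of_real pi * \<i> / 2) = \<i>"
      using cis_pi_half by (simp add: cis_conv_exp mult.commute)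
    finally show ?thesis by simp
  qed
  moreover have "epow x (z + 1/2) = epow x z * epow x (1/2)" for x
    by (simp add: epow_def exp_add[symmetric] algebra_simps)
  ultimately have "theta_term 1 (1/2) (1/2) (z + 1/2) \<tau> n = \<i> * (neg1pow n * theta_term 1 (1/2) (1/2) z \<tau> n)" for n
    by (simp add: theta_term_def)
  then have "theta_term 1 (1/2) (1/2) (z + 1/2) \<tau> = (\<lambda>n. \<i> * (neg1pow n * theta_term 1 (1/2) (1/2) z \<tau> n))"
    by (rule ext)
  then have "\<i> * theta1 z \<tau> = (\<Sum>\<^sub>\<infinity>n\<in>UNIV. neg1pow n * theta_term 1 (1/2) (1/2) z \<tau> n)"
    by (simp add: theta1_def theta2_eq infsum_cmult_right')
  also have "\<dots> = residue_sum (theta_term 1 (1/2) (1/2) z \<tau>) 2 0 - residue_sum (theta_term 1 (1/2) (1/2) z \<tau>) 2 (-1)"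
    by (intro infsumI has_sum_alternating theta_term_abs_summable) (use assms in auto)
  also have "residue_sum (theta_term 1 (1/2) (1/2) z \<tau>) 2 0 = Theta 2 4 (z/2) (\<tau>/2)"
    unfolding Theta_eq residue_sum_def theta_term_def t2 epow_divide
    by (intro infsum_cong epow_eqI) (auto simp: power2_eq_square field_simps)
  also have "residue_sum (theta_term 1 (1/2) (1/2) z \<tau>) 2 (-1) = Theta (-2) 4 (z/2) (\<tau>/2)"
    unfolding Theta_eq residue_sum_def theta_term_def t2 epow_divide
    by (intro infsum_cong epow_eqI) (auto simp: power2_eq_square field_simps)
  finally show ?thesis .
qed

text \<open>Here \<Delta> = 4, so only i = 1 remains. Its two factors are Theta_{2,4} - Theta_{-2,4}
  and Theta_{2,12} - Theta_{-10,12}, that is, i theta_1 and eta, and the numerator on the left is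
  \<Pi> itself.\<close>

lemma quintuple_product:
  assumes "Im \<tau> > 0"
  shows "Pi_osp z \<tau> * theta2 (z/2) \<tau> = \<i> * theta1 z \<tau> * dedekind_eta \<tau>"
  using branching_identity[of 3 1 4 1 0 \<tau> z] assms
  by (simp add: Pi_osp_def theta1_eq_Theta dedekind_eta_eq_Theta)

text \<open>At z = -1/2 the shift in the definition leads to theta_2 at 0, and at \<tau> = i all its
  terms are positive reals. This provides the point at which the denominators do not vanish.\<close>

lemma theta1_nonzero: "theta1 (- 1/2) \<i> \<noteq> 0"
proof -
  define f where "f n = exp (- pi * (of_int n + 1/2)\<^sup>2)" for n :: int
  have tt: "theta_term 1 (1/2) (1/2) 0 \<i> n = of_real (f n)" for n
  proof -
    have "epow x \<i> = of_real (exp (- (2 * pi * x)))" for x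
      unfolding epow_def of_real_exp
      by (rule arg_cong[where f = exp]) (simp add: complex_eq_iff)
    then show ?thesis by (simp add: theta_term_def f_def)
  qed
  have "(theta_term 1 (1/2) (1/2) 0 \<i> has_sum theta2 0 \<i>) UNIV"
    unfolding theta2_eq
    by (rule has_sum_infsum[OF abs_summable_summable[OF theta_term_abs_summable]]) simp_all
  from has_sum_Re[OF this] have hs: "(f has_sum Re (theta2 0 \<i>)) UNIV"
    by (simp add: tt)
  have "sum f {0} \<le> Re (theta2 0 \<i>)"
    by (rule finite_sum_le_has_sum[OF hs]) (auto simp: f_def)
  then have "Re (theta2 0 \<i>) > 0" by (simp add: f_def less_le_trans[OF exp_gt_zero])
  then show ?thesis by (auto simp: theta1_def)
qed

subsection \<open>Meromorphic functions of two variables\<close>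

lemma holomorphic2_on_iff:
  "holomorphic2_on f D \<longleftrightarrow> (\<forall>x\<in>D. \<exists>a b. (f has_derivative (\<lambda>h. a * fst h + b * snd h)) (at x))"
  by (simp add: holomorphic2_on_def case_prod_unfold)

lemma holomorphic2_onE:
  assumes "holomorphic2_on f D" "x \<in> D"
  obtains a b where "(f has_derivative (\<lambda>h. a * fst h + b * snd h)) (at x)"
  using assms unfolding holomorphic2_on_iff by blast

lemma holomorphic2_onI:
  assumes "\<And>x. x \<in> D \<Longrightarrow> \<exists>a b. (f has_derivative (\<lambda>h. a * fst h + b * snd h)) (at x)"
  shows "holomorphic2_on f D"
  using assms unfolding holomorphic2_on_iff by blast

lemma holomorphic2_on_mult:
  assumes "holomorphic2_on f D" "holomorphic2_on g D"
  shows "holomorphic2_on (\<lambda>x. f x * g x) D"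
proof (rule holomorphic2_onI)
  fix x assume x: "x \<in> D"
  obtain a b where f: "(f has_derivative (\<lambda>h. a * fst h + b * snd h)) (at x)"
    using assms(1) x by (rule holomorphic2_onE)
  obtain c d where g: "(g has_derivative (\<lambda>h. c * fst h + d * snd h)) (at x)"
    using assms(2) x by (rule holomorphic2_onE)
  have "((\<lambda>x. f x * g x) has_derivative (\<lambda>h. (f x * c + a * g x) * fst h + (f x * d + b * g x) * snd h)) (at x)"
    by (rule has_derivative_eq_rhs[OF has_derivative_mult[OF f g]]) (simp add: fun_eq_iff algebra_simps)
  then show "\<exists>a b. ((\<lambda>x. f x * g x) has_derivative (\<lambda>h. a * fst h + b * snd h)) (at x)" by blast
qed

lemma holomorphic2_on_diff:
  assumes "holomorphic2_on f D" "holomorphic2_on g D"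
  shows "holomorphic2_on (\<lambda>x. f x - g x) D"
proof (rule holomorphic2_onI)
  fix x assume x: "x \<in> D"
  obtain a b where f: "(f has_derivative (\<lambda>h. a * fst h + b * snd h)) (at x)"
    using assms(1) x by (rule holomorphic2_onE)
  obtain c d where g: "(g has_derivative (\<lambda>h. c * fst h + d * snd h)) (at x)"
    using assms(2) x by (rule holomorphic2_onE)
  have "((\<lambda>x. f x - g x) has_derivative (\<lambda>h. (a - c) * fst h + (b - d) * snd h)) (at x)"
    by (rule has_derivative_eq_rhs[OF has_derivative_diff[OF f g]]) (simp add: fun_eq_iff algebra_simps)
  then show "\<exists>a b. ((\<lambda>x. f x - g x) has_derivative (\<lambda>h. a * fst h + b * snd h)) (at x)" by blast
qed

lemma holomorphic2_on_sum:
  assumes "\<And>i. i \<in> I \<Longrightarrow> holomorphic2_on (f i) D"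
  shows "holomorphic2_on (\<lambda>x. \<Sum>i\<in>I. f i x) D"
proof (rule holomorphic2_onI)
  fix x assume x: "x \<in> D"
  have "\<forall>i\<in>I. \<exists>a b. (f i has_derivative (\<lambda>h. a * fst h + b * snd h)) (at x)"
    using assms x unfolding holomorphic2_on_iff by blast
  then obtain a b where "\<And>i. i \<in> I \<Longrightarrow> (f i has_derivative (\<lambda>h. a i * fst h + b i * snd h)) (at x)"
    by metis
  from has_derivative_sum[of I f, OF this]
  have "((\<lambda>x. \<Sum>i\<in>I. f i x) has_derivative (\<lambda>h. (\<Sum>i\<in>I. a i) * fst h + (\<Sum>i\<in>I. b i) * snd h)) (at x)"
    by (simp add: sum.distrib sum_distrib_right)
  then show "\<exists>a b. ((\<lambda>x. \<Sum>i\<in>I. f i x) has_derivative (\<lambda>h. a * fst h + b * snd h)) (at x)" by blast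
qed

lemma affine2_has_derivative:
  fixes a b c :: complex
  shows "((\<lambda>x. a * fst x + b * snd x + c) has_derivative (\<lambda>h. a * fst h + b * snd h)) (at x within S)"
  by (rule has_derivative_eq_rhs, (rule derivative_intros)+) simp

lemma holomorphic2_on_affine:
  assumes f: "holomorphic2_on f E"
    and sub: "\<And>x. x \<in> D \<Longrightarrow> (a * fst x + b * snd x + c, a' * fst x + b' * snd x + c') \<in> E"
  shows "holomorphic2_on (\<lambda>x. f (a * fst x + b * snd x + c, a' * fst x + b' * snd x + c')) D"
proof (rule holomorphic2_onI)
  fix x assume x: "x \<in> D"
  obtain A B where "(f has_derivative (\<lambda>h. A * fst h + B * snd h))
      (at (a * fst x + b * snd x + c, a' * fst x + b' * snd x + c'))"
    using f sub[OF x] by (rule holomorphic2_onE)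
  from has_derivative_compose[OF has_derivative_Pair[OF affine2_has_derivative affine2_has_derivative] this]
  have "((\<lambda>x. f (a * fst x + b * snd x + c, a' * fst x + b' * snd x + c')) has_derivative
     (\<lambda>h. (A * a + B * a') * fst h + (A * b + B * b') * snd h)) (at x)"
    by (rule has_derivative_eq_rhs) (simp add: fun_eq_iff algebra_simps)
  then show "\<exists>a'' b''. ((\<lambda>x. f (a * fst x + b * snd x + c, a' * fst x + b' * snd x + c'))
      has_derivative (\<lambda>h. a'' * fst h + b'' * snd h)) (at x)" by blast
qed

lemma holomorphic2_on_epow: "holomorphic2_on (\<lambda>x. epow \<alpha> (a * fst x + b * snd x + c)) D"
proof (rule holomorphic2_onI)
  fix x :: "complex \<times> complex"
  define K where "K = 2 * of_real pi * \<i> * of_real \<alpha>"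
  have "(epow \<alpha> has_field_derivative epow \<alpha> w * K) (at w)" for w
    unfolding epow_def K_def by (auto intro!: derivative_eq_intros)
  then have "(epow \<alpha> has_derivative (*) (epow \<alpha> w * K)) (at w)" for w
    by (rule has_field_derivative_imp_has_derivative)
  from has_derivative_compose[OF affine2_has_derivative this]
  have "((\<lambda>x. epow \<alpha> (a * fst x + b * snd x + c)) has_derivative
     (\<lambda>h. (epow \<alpha> (a * fst x + b * snd x + c) * K * a) * fst h
        + (epow \<alpha> (a * fst x + b * snd x + c) * K * b) * snd h)) (at x)"
    by (rule has_derivative_eq_rhs) (simp add: fun_eq_iff algebra_simps)
  then show "\<exists>A B. ((\<lambda>x. epow \<alpha> (a * fst x + b * snd x + c)) has_derivative (\<lambda>h. A * fst h + B * snd h)) (at x)"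
    by blast
qed

section \<open>Holomorphy of the theta functions in both variables\<close>

abbreviation "upper_half_domain \<equiv> (UNIV :: complex set) \<times> {\<tau>. Im \<tau> > 0}"

lemma holomorphic2_on_theta_series:
  fixes d :: real
  assumes "\<gamma> > 0" "d > 0"
  shows "holomorphic2_on (\<lambda>x. infsum (theta_term \<alpha> \<beta> \<gamma> (a * fst x + c) (of_real d * snd x)) UNIV) upper_half_domain"
proof -
  \<comment> \<open>By \<open>infsum_theta_term\<close> the series is an exponential factor times
    \<open>jtheta\<close> composed with this affine map of (z, \<tau>), whose second component stays
    in the upper half-plane.\<close>
  have 1: "holomorphic2_on (\<lambda>x. (\<lambda>(u, v). jtheta u v)
      ((of_real \<alpha> * a) * fst x + of_real (2 * \<gamma> * \<beta> * d) * snd x + of_real \<alpha> * c,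
       0 * fst x + of_real (\<gamma> * d) * snd x + 0)) upper_half_domain"
    by (rule holomorphic2_on_affine[OF jtheta_holomorphic2]) (use assms in auto)
  have 2: "holomorphic2_on (\<lambda>x. epow (\<alpha> * \<beta>) (a * fst x + 0 * snd x + c) *
      epow (\<gamma> * \<beta>\<^sup>2) (0 * fst x + of_real d * snd x + 0)) upper_half_domain"
    by (intro holomorphic2_on_mult holomorphic2_on_epow)
  from holomorphic2_on_mult[OF 2 1] show ?thesis
    by (simp add: infsum_theta_term algebra_simps)
qed

lemma holomorphic2_on_Theta:
  assumes "s > 0"
  shows "holomorphic2_on (\<lambda>x. Theta r s (fst x / c) (snd x / 2)) upper_half_domain"
  using holomorphic2_on_theta_series[of "of_int s" "1/2" "of_int s" "of_int r / (2 * of_int s)" "1/c" 0] assms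
  by (simp add: Theta_eq)

lemma holomorphic2_on_Theta_0:
  assumes "s > 0"
  shows "holomorphic2_on (\<lambda>x. Theta r s 0 (snd x / 2)) upper_half_domain"
  using holomorphic2_on_theta_series[of "of_int s" "1/2" "of_int s" "of_int r / (2 * of_int s)" 0 0] assms
  by (simp add: Theta_eq)

lemma holomorphic2_on_cong:
  assumes "open D" "\<And>x. x \<in> D \<Longrightarrow> f x = g x"
  shows "holomorphic2_on f D \<longleftrightarrow> holomorphic2_on g D"
proof -
  have "(f has_derivative F) (at x) \<longleftrightarrow> (g has_derivative F) (at x)" if "x \<in> D" for x F
    using has_derivative_transform_within_open[of f F x UNIV D g]
      has_derivative_transform_within_open[of g F x UNIV D f] assms that by auto
  then show ?thesis by (auto simp: holomorphic2_on_def)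
qed

lemma holomorphic2_on_imp_continuous_on: "holomorphic2_on f D \<Longrightarrow> continuous_on D f"
  by (meson continuous_at_imp_continuous_on has_derivative_continuous holomorphic2_onE)

text \<open>Restricting to the complex line through a given point and a point where \<open>h\<close> is
  nonzero reduces the claim to the identity theorem in one variable.\<close>

lemma dense_nonzero:
  assumes h: "holomorphic2_on h D" and D: "open D" "convex D"
    and x1: "x1 \<in> D" "h x1 \<noteq> 0"
  shows "D \<subseteq> closure {x \<in> D. h x \<noteq> 0}"
proof
  fix x0 assume x0: "x0 \<in> D"
  define g where "g w = (fst x0 + w * (fst x1 - fst x0), snd x0 + w * (snd x1 - snd x0))" for w :: complex
  define S where "S = g -` D"
  have cg: "continuous_on UNIV g" unfolding g_def by (intro continuous_intros)
  have opS: "open S" unfolding S_def using D cg by (simp add: open_vimage)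
  have "convex S"
  proof (rule convexI)
    fix v w :: complex and a b :: real
    assume *: "v \<in> S" "w \<in> S" "0 \<le> a" "0 \<le> b" "a + b = 1"
    have b: "b = 1 - a" using * by simp
    have "g (a *\<^sub>R v + b *\<^sub>R w) = a *\<^sub>R g v + b *\<^sub>R g w"
      unfolding b by (simp add: g_def scaleR_conv_of_real algebra_simps)
    then show "a *\<^sub>R v + b *\<^sub>R w \<in> S"
      using * D(2) by (simp add: S_def convex_def)
  qed
  then have cnS: "connected S" by (rule convex_connected)
  have g01: "g 0 = x0" "g 1 = x1" by (simp_all add: g_def)
  have hol: "(\<lambda>w. h (g w)) holomorphic_on S"
  proof (rule holomorphic_onI)
    fix w assume "w \<in> S"
    then have "g w \<in> D" by (simp add: S_def)
    then obtain a b where "(h has_derivative (\<lambda>k. a * fst k + b * snd k)) (at (g w))"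
      by (rule holomorphic2_onE[OF h])
    moreover have "(g has_derivative (\<lambda>k. (k * (fst x1 - fst x0), k * (snd x1 - snd x0)))) (at w within S)"
      unfolding g_def by (rule has_derivative_eq_rhs, (rule derivative_intros)+) simp
    ultimately have "((\<lambda>w. h (g w)) has_derivative
        (\<lambda>k. a * (k * (fst x1 - fst x0)) + b * (k * (snd x1 - snd x0)))) (at w within S)"
      using has_derivative_compose by fastforce
    then have "((\<lambda>w. h (g w)) has_field_derivative
        (a * (fst x1 - fst x0) + b * (snd x1 - snd x0))) (at w within S)"
      unfolding has_field_derivative_def
      by (rule has_derivative_eq_rhs) (simp add: fun_eq_iff algebra_simps)
    then show "(\<lambda>w. h (g w)) field_differentiable (at w within S)"
      by (auto simp: field_differentiable_def)
  qed
  show "x0 \<in> closure {x \<in> D. h x \<noteq> 0}"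
  proof (rule ccontr)
    assume "x0 \<notin> closure {x \<in> D. h x \<noteq> 0}"
    define V where "V = - closure {x \<in> D. h x \<noteq> 0}"
    have V: "open V" "x0 \<in> V" using \<open>x0 \<notin> _\<close> by (auto simp: V_def)
    have V0: "h x = 0" if "x \<in> V" "x \<in> D" for x
      using that closure_subset[of "{x \<in> D. h x \<noteq> 0}"] by (auto simp: V_def)
    have "h (g 1) = 0"
    proof (rule analytic_continuation_open[where s = "S \<inter> g -` V" and s' = S
          and f = "\<lambda>w. h (g w)" and g = "\<lambda>_. 0"])
      show "open (S \<inter> g -` V)" using V(1) cg opS by (auto intro: open_vimage)
      have "0 \<in> S \<inter> g -` V" using x0 V g01 by (simp add: S_def)
      then show "S \<inter> g -` V \<noteq> {}" by blast
      show "h (g z) = 0" if "z \<in> S \<inter> g -` V" for z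
        using that V0 by (auto simp: S_def)
      show "1 \<in> S" using x1 g01 by (simp add: S_def)
    qed (use opS cnS hol in auto)
    then show False using x1 g01 by simp
  qed
qed

lemma meromorphic2_on_quotient:
  assumes "open D" "holomorphic2_on g D" "holomorphic2_on h D" "D \<subseteq> closure {x \<in> D. h x \<noteq> 0}"
    and "\<And>x. x \<in> D \<Longrightarrow> h x \<noteq> 0 \<Longrightarrow> f x = g x / h x"
  shows "meromorphic2_on f D"
  unfolding meromorphic2_on_def using assms by blast

section \<open>Division by the denominators\<close>

theorem lemma2p1:
  fixes p p' \<Delta> r s :: int and k :: rat
  assumes "p > 1" and "p' > 0" and "coprime p p'"
    and "even (p + p')" and "coprime p ((p + p') div 2)"
    and "k + 3/2 = of_int p / (2 * of_int p')"
    and "\<Delta> = p + p'"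
    and "1 \<le> r" and "r \<le> p - 1" and "0 \<le> s" and "s \<le> p' - 1" and "odd (r + s)"
  shows "meromorphic2_eq_on (UNIV \<times> {\<tau>. Im \<tau> > 0})
    (\<lambda>(z, \<tau>). ch_M p p' r s z \<tau>)
    (\<lambda>(z, \<tau>). \<Sum>i = 1..\<Delta> div 2 - 1. ch_D \<Delta> p' i s z \<tau> * ch_V \<Delta> p i r \<tau>)"
proof -
  let ?D = upper_half_domain
  have opD: "open ?D" and cvD: "convex ?D"
    by (intro open_Times open_UNIV open_halfspace_Im_gt)
       (intro convex_Times convex_UNIV convex_halfspace_Im_gt)
  define numM where "numM x = Theta (p' * r - p * s) (p * p') (fst x / (2 * of_int p')) (snd x / 2)
     - Theta (- p' * r - p * s) (p * p') (fst x / (2 * of_int p')) (snd x / 2)" for x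
  define numD where "numD i x = Theta (2 * p' * i - \<Delta> * s) (\<Delta> * p') (fst x / (2 * of_int p')) (snd x / 2)
     - Theta (- 2 * p' * i - \<Delta> * s) (\<Delta> * p') (fst x / (2 * of_int p')) (snd x / 2)" for i x
  define numV where "numV i x = Theta (2 * p * i - \<Delta> * r) (\<Delta> * p) 0 (snd x / 2)
     - Theta (- 2 * p * i - \<Delta> * r) (\<Delta> * p) 0 (snd x / 2)" for i and x :: "complex \<times> complex"
  define S where "S x = (\<Sum>i = 1..\<Delta> div 2 - 1. numD i x * numV i x)" for x
  define \<Phi> where "\<Phi> x = Pi_osp (fst x) (snd x)" for x
  define \<Psi> where "\<Psi> x = \<i> * theta1 (fst x) (snd x) * dedekind_eta (snd x)" for x
  have pos: "p > 0" "p' > 0" "\<Delta> > 0" using assms by auto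
  have branching: "numM x * theta2 (fst x / 2) (snd x) = S x" if "x \<in> ?D" for x
    using branching_identity[of p p' \<Delta> r s "snd x" "fst x"] assms that
    by (auto simp: numM_def numD_def numV_def S_def)
  have quintuple: "\<Phi> x * theta2 (fst x / 2) (snd x) = \<Psi> x" if "x \<in> ?D" for x
    using quintuple_product[of "snd x" "fst x"] that by (auto simp: \<Phi>_def \<Psi>_def)
  have hol: "holomorphic2_on numM ?D" "holomorphic2_on S ?D" "holomorphic2_on \<Phi> ?D"
    unfolding numM_def numD_def numV_def S_def \<Phi>_def Pi_osp_def using pos
    by (intro holomorphic2_on_sum holomorphic2_on_mult holomorphic2_on_diff holomorphic2_on_Theta
        holomorphic2_on_Theta_0; simp)+
  \<comment> \<open>Holomorphy of \<Psi> is read off its theta-series form, not off the infinite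
    product defining eta.\<close>
  have "holomorphic2_on (\<lambda>x. (Theta 2 4 (fst x / 2) (snd x / 2) - Theta (-2) 4 (fst x / 2) (snd x / 2)) *
      (Theta 2 12 0 (snd x / 2) - Theta (-10) 12 0 (snd x / 2))) ?D"
    by (intro holomorphic2_on_mult holomorphic2_on_diff holomorphic2_on_Theta holomorphic2_on_Theta_0) auto
  also have "?this \<longleftrightarrow> holomorphic2_on \<Psi> ?D"
    by (rule holomorphic2_on_cong[OF opD]) (auto simp: \<Psi>_def theta1_eq_Theta dedekind_eta_eq_Theta)
  finally have hol\<Psi>: "holomorphic2_on \<Psi> ?D" .
  \<comment> \<open>Since \<Psi> is a multiple of \<Phi>, this one point serves both
    denominators.\<close>
  have x1: "(- 1/2, \<i>) \<in> ?D" "\<Psi> (- 1/2, \<i>) \<noteq> 0"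
    using theta1_nonzero dedekind_eta_nonzero[of \<i>] by (auto simp: \<Psi>_def)
  then have "\<Phi> (- 1/2, \<i>) \<noteq> 0" using quintuple[of "(- 1/2, \<i>)"] by auto
  then have dense\<Phi>: "?D \<subseteq> closure {x \<in> ?D. \<Phi> x \<noteq> 0}"
    by (rule dense_nonzero[OF hol(3) opD cvD x1(1)])
  have dense\<Psi>: "?D \<subseteq> closure {x \<in> ?D. \<Psi> x \<noteq> 0}"
    by (rule dense_nonzero[OF hol\<Psi> opD cvD x1])
  \<comment> \<open>Both rewritings hold at every point, including zeros of the denominators,
    because division by zero gives zero and still respects products.\<close>
  have chM: "ch_M p p' r s (fst x) (snd x) = numM x / \<Phi> x" for x
    by (simp add: ch_M_def numM_def \<Phi>_def)
  have chDV: "(\<Sum>i = 1..\<Delta> div 2 - 1. ch_D \<Delta> p' i s (fst x) (snd x) * ch_V \<Delta> p i r (snd x)) = S x / \<Psi> x" for x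
    by (simp add: ch_D_def ch_V_def numD_def numV_def S_def \<Psi>_def sum_divide_distrib)
  have "open {x \<in> ?D. \<Psi> x \<noteq> 0}"
    using continuous_open_preimage[OF holomorphic2_on_imp_continuous_on[OF hol\<Psi>] opD, of "- {0}"]
    by (simp add: vimage_def Int_def open_Compl)
  \<comment> \<open>Where \<Psi> is nonzero, so is its factor theta_2, and this factor cancels from
    S/\<Psi>.\<close>
  moreover have "numM x / \<Phi> x = S x / \<Psi> x" if "x \<in> ?D" "\<Psi> x \<noteq> 0" for x
  proof -
    have "theta2 (fst x / 2) (snd x) \<noteq> 0" using quintuple[OF that(1)] that(2) by auto
    then show ?thesis by (simp add: branching[OF that(1), symmetric] quintuple[OF that(1), symmetric])
  qed
  ultimately show ?thesis
    unfolding meromorphic2_eq_on_def case_prod_unfold chM chDV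
    using meromorphic2_on_quotient[OF opD hol(1) hol(3) dense\<Phi>]
      meromorphic2_on_quotient[OF opD hol(2) hol\<Psi> dense\<Psi>] dense\<Psi>
    by (intro conjI exI[of _ "{x \<in> ?D. \<Psi> x \<noteq> 0}"]) auto
qed

end
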